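(* Let $\Omega\subset\mathbb{X}$ be closed, let $r\in\{1,\ldots,n\}$ be such that $\Gamma_r:=\{X\in\Omega\,|\,\mathrm{rank}(X)\le r\}$ is nonempty, and let $f:\mathbb{X}\to(-\infty,+\infty]$ be bounded from below, coercive on $\Omega$ and locally Lipschitz continuous on $\Omega$. Let $H_r(X):=\sum_{i=1}^{r-1}\sigma_i(X)+\sqrt{\sum_{i=r}^n\sigma_i^2(X)}$ for $X\in\mathbb{X}$, and let $\mathcal{M}_r:\mathbb{R}\rightrightarrows\mathbb{X}$ be the multifunction $$\mathcal{M}_r(\tau):=\big\{X\in\Omega\,|\,\|X\|_*-H_r(X)=\tau\big\}.$$ Fix any $\overline{X}\in\Gamma_r$. Then $\mathcal{S}_r$ is calm at $0$ for $\overline{X}$ if and only if $\mathcal{M}_r$ is calm at $0$ for $\overline{X}$. Consequently, if either (a) $[-\mathcal{N}_{\Omega}(X)]\cap\mathcal{N}_{\Lambda_r}(X)=\{0\}$ for every $X\in\Gamma_r$, or (b) $\mathbb{X}=\mathbb{S}^n$, $\Omega=\mathbb{S}_+^n\cap\Xi$ for a closed set $\Xi\subset\mathbb{S}^n$, and $[-\mathcal{N}_{\Xi}(X)]\cap\mathcal{N}_{\Lambda_r^{+}}(X)=\{0\}$ for every $X\in\Gamma_r$, then there exists $\overline{\rho}>0$ such that for every $\rho\ge\overline{\rho}$ the problem $$\min_{X\in\Omega}\big\{f(X)+\rho\big[\|X\|_*-H_r(X)\big]\big\}$$ has the same global optimal solution set as the problem $\min_{X\in\Omega}\{f(X)\ \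 \text{s.t.}\ \ \mathrm{rank}(X)\le r\}$.
   Context: $\mathbb{X}$ denotes either $\mathbb{R}^{n\times m}$ (with $n\le m$) or the space $\mathbb{S}^n$ of $n\times n$ real symmetric matrices, equipped with the trace inner product and the Frobenius norm; $\mathbb{S}_+^n$ is the cone of positive semidefinite matrices. $\Lambda_r:=\{X\in\mathbb{X}\,|\,\mathrm{rank}(X)\le r\}$ and $\Lambda_r^{+}:=\{X\in\mathbb{S}_+^n\,|\,\mathrm{rank}(X)\le r\}$. $\sigma_1(X)\ge\cdots\ge\sigma_n(X)$ are the singular values of $X$; $\|X\|_*=\sum_{i=1}^n\sigma_i(X)$ is the nuclear norm and $\|X\|_{(r)}=\sum_{i=1}^r\sigma_i(X)$ is the Ky-Fan $r$-norm. The multifunction $\mathcal{S}_r:\mathbb{R}\rightrightarrows\mathbb{X}$ is $\mathcal{S}_r(\tau):=\{X\in\Omega\,|\,\|X\|_*-\|X\|_{(r)}=\tau\}$. $f$ coercive on $\Omega$ means $f(X)\to+\infty$ as $\|X\|_F\to\infty$ with $X\in\Omega$. $f$ locally Lipschitz continuous on $\Omega$ means $f$ is finite on $\Omega$ and each point of $\Omega$ has a neighborhood $N$ such that $f$ is Lipschitz on $N\cap\Omega$. Calmness: a multifunction $\mathcal{M}:\mathbb{Y}\rightrightarrows\mathbb{Z}$ between finite-dimensional Euclidean spaces is calm at $\overline{y}$ for $\overline{z}\in\mathcal{M}(\overline{y})$ if there exist $\gamma\ge0$, $\varepsilon>0$, $\delta>0$ such that for all $y$ with $\|y-\overline{y}\|\le\varepsilon$,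 $\mathcal{M}(y)\cap\mathbb{B}(\overline{z},\delta)\subseteq\mathcal{M}(\overline{y})+\gamma\|y-\overline{y}\|\mathbb{B}_{\mathbb{Z}}$, where $\mathbb{B}(\overline z,\delta)$ is the closed ball and $\mathbb{B}_{\mathbb{Z}}$ the closed unit ball. Normal cones: for a closed set $S\subseteq\mathbb{X}$ and $\overline{x}\in S$, the Fréchet normal cone is $\widehat{\mathcal{N}}_S(\overline{x}):=\{v\in\mathbb{X}\,|\,\limsup_{x\to\overline{x},\,x\in S,\,x\ne\overline{x}}\langle v,x-\overline{x}\rangle/\|x-\overline{x}\|\le0\}$, and the limiting normal cone $\mathcal{N}_S(\overline{x})$ is the set of $v$ for which there exist $x^k\in S$, $x^k\to\overline{x}$, and $v^k\in\widehat{\mathcal{N}}_S(x^k)$ with $v^k\to v$. *)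

theory Defs
  imports "HOL-Analysis.Analysis" "HOL-Computational_Algebra.Polynomial" "HOL-Library.Multiset"
begin

text \<open>
  A matrix with n rows and m columns has type \<open>real^'m^'n\<close>, with n = \<open>CARD('n)\<close> and
  m = \<open>CARD('m)\<close>.  The library norm and inner product of this type are the Frobenius norm and
  the trace inner product.  The space of symmetric matrices is the linear subspace
  \<open>sym_matrices\<close> of \<open>real^'n^'n\<close>, with the inherited norm and inner product; notions that
  depend on the ambient space take it as an argument \<open>E\<close>.
\<close>

definition sym_matrices :: "(real^'n^'n) set" where
  "sym_matrices = {A. transpose A = A}"

definition psd_matrices :: "(real^'n^'n) set" where
  "psd_matrices = {A \<in> sym_matrices. \<forall>x. 0 \<le> x \<bullet> (A *v x)}"


subsection \<open>Singular values\<close>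

definition charpoly :: "real^'n^'n \<Rightarrow> real poly" where
  "charpoly A = det (mat (monom 1 1) - (\<chi> i j. [:A $ i $ j:]))"

text \<open>
  The square roots of the eigenvalues of \<open>A ** transpose A\<close>, counted with multiplicity and listed in
  nonincreasing order.  As \<open>A ** transpose A\<close> is symmetric, its characteristic polynomial splits over the
  reals, so that the list has length n.
\<close>

definition singular_values :: "real^'m^'n \<Rightarrow> real list" where
  "singular_values A =
     rev (sorted_list_of_multiset (image_mset sqrt (proots (charpoly (A ** transpose A)))))"

text \<open>The index i ranges over 1, ..., n.\<close>

definition sing_val :: "real^'m^'n \<Rightarrow> nat \<Rightarrow> real" where
  "sing_val A i = singular_values A ! (i - 1)"

definition nuclear_norm :: "real^'m^'n \<Rightarrow> real" where
  "nuclear_norm A = (\<Sum>i = 1..CARD('n). sing_val A i)"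

definition ky_fan_norm :: "nat \<Rightarrow> real^'m^'n \<Rightarrow> real" where
  "ky_fan_norm r A = (\<Sum>i = 1..r. sing_val A i)"

definition H_fun :: "nat \<Rightarrow> real^'m^'n \<Rightarrow> real" where
  "H_fun r A = (\<Sum>i = 1..r - 1. sing_val A i) + sqrt (\<Sum>i = r..CARD('n). (sing_val A i)\<^sup>2)"


subsection \<open>Rank constraints and the associated multifunctions\<close>

definition low_rank :: "(real^'m^'n) set \<Rightarrow> nat \<Rightarrow> (real^'m^'n) set" where
  "low_rank S r = {A \<in> S. rank A \<le> r}"

definition S_map :: "(real^'m^'n) set \<Rightarrow> nat \<Rightarrow> real \<Rightarrow> (real^'m^'n) set" where
  "S_map \<Omega> r \<tau> = {A \<in> \<Omega>. nuclear_norm A - ky_fan_norm r A = \<tau>}"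

definition M_map :: "(real^'m^'n) set \<Rightarrow> nat \<Rightarrow> real \<Rightarrow> (real^'m^'n) set" where
  "M_map \<Omega> r \<tau> = {A \<in> \<Omega>. nuclear_norm A - H_fun r A = \<tau>}"


subsection \<open>Variational analysis\<close>

text \<open>
  If \<open>M\<close> takes values in a linear subspace, it does not matter whether the balls are
  taken in the subspace or in the whole space.
\<close>

definition calm_at ::
  "('y::euclidean_space \<Rightarrow> 'z::euclidean_space set) \<Rightarrow> 'y \<Rightarrow> 'z \<Rightarrow> bool" where
  "calm_at M y0 z0 \<longleftrightarrow> z0 \<in> M y0 \<and>
     (\<exists>\<gamma>\<ge>0. \<exists>\<epsilon>>0. \<exists>\<delta>>0. \<forall>y. norm (y - y0) \<le> \<epsilon> \<longrightarrow>
        M y \<inter> cball z0 \<delta> \<subseteq>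
          {z + (\<gamma> * norm (y - y0)) *\<^sub>R b | z b. z \<in> M y0 \<and> b \<in> cball 0 1})"

text \<open>
  At an isolated point of \<open>S\<close> the filter is trivial and the upper limit is \<open>-\<infinity>\<close>, so that
  the normal cone is the whole space \<open>E\<close>.
\<close>

definition frechet_normal_cone :: "'a::euclidean_space set \<Rightarrow> 'a set \<Rightarrow> 'a \<Rightarrow> 'a set" where
  "frechet_normal_cone E S x0 =
     {v \<in> E. Limsup (at x0 within S) (\<lambda>x. ereal ((v \<bullet> (x - x0)) / norm (x - x0))) \<le> 0}"

definition limiting_normal_cone :: "'a::euclidean_space set \<Rightarrow> 'a set \<Rightarrow> 'a \<Rightarrow> 'a set" where
  "limiting_normal_cone E S x0 =
     {v \<in> E. \<exists>x w. (\<forall>k::nat. x k \<in> S \<and> w k \<in> frechet_normal_cone E S (x k)) \<and>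
        x \<longlonglongrightarrow> x0 \<and> w \<longlonglongrightarrow> v}"


subsection \<open>Extended-real-valued functions\<close>

text \<open>The real lower bound also excludes the value \<open>-\<infinity>\<close>.\<close>

definition bounded_below_on :: "'a set \<Rightarrow> ('a \<Rightarrow> ereal) \<Rightarrow> bool" where
  "bounded_below_on E f \<longleftrightarrow> (\<exists>c::real. \<forall>x\<in>E. ereal c \<le> f x)"

definition coercive_on :: "'a::real_normed_vector set \<Rightarrow> ('a \<Rightarrow> ereal) \<Rightarrow> bool" where
  "coercive_on S f \<longleftrightarrow> (f \<longlongrightarrow> \<infinity>) (inf at_infinity (principal S))"

definition locally_lipschitz_on :: "'a::metric_space set \<Rightarrow> ('a \<Rightarrow> ereal) \<Rightarrow> bool" where
  "locally_lipschitz_on S f \<longleftrightarrow> (\<forall>x\<in>S. \<bar>f x\<bar> \<noteq> \<infinity>) \<and>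
     (\<forall>x\<in>S. \<exists>N L. open N \<and> x \<in> N \<and> L-lipschitz_on (N \<inter> S) (\<lambda>y. real_of_ereal (f y)))"

definition global_minimizers :: "'a set \<Rightarrow> ('a \<Rightarrow> ereal) \<Rightarrow> 'a set" where
  "global_minimizers S g = {x. is_arg_min g (\<lambda>x. x \<in> S) x}"

end

theory Submission
  imports Defs
begin

text \<open>
  Write \<open>K\<close> for the nuclear norm minus the Ky Fan \<open>r\<close>-norm, that is the sum of the singular values
  after the \<open>r\<close>-th one, and \<open>T\<close> for the nuclear norm minus \<open>H_fun r\<close>.  Both depend on the ordered
  singular values only, and the elementary inequalities \<open>K / 2 \<le> T \<le> K\<close>
  (\<open>nuclear_minus_H_bounds\<close>) make the two level-set multifunctions interchangeable up to a
  factor 2 in the calmness constants.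

  For the exact penalty, the core is a local error bound: near a feasible point, the distance of a
  point of \<open>\<Omega>\<close> to the feasible set is at most a multiple of \<open>K\<close>.  It has two sources.
  Truncating a singular value decomposition (or, for symmetric and for positive semidefinite
  matrices, a spectral decomposition) shows that \<open>K\<close> bounds the distance to the matrices of rank
  at most \<open>r\<close> in the respective class (\<open>infdist_low_rank_le\<close>, \<open>infdist_low_rank_sym_le\<close>,
  \<open>infdist_low_rank_psd_le\<close>).  The normal cone condition lets one pass from the distance to the rank
  constraint to the distance to its intersection with the other constraint set
  (\<open>normal_qualification_error_bound\<close>): if that failed, minimising a distance with a small quadratic
  perturbation would yield almost opposite normals to the two sets with lengths close to 1, and
  these would have nonzero limits.  In alternative (b) the two sets are \<open>\<Xi>\<close> and the positive semidefinite matrices of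
  rank at most \<open>r\<close>.

  An error bound near every feasible point, together with local Lipschitz continuity there and
  penalties bounded away from 0 near every infeasible point, gives local lower bounds for the
  penalised objective.  Coercivity confines the problem to a compact set, on which finitely many of
  these local bounds suffice (\<open>exact_penalization\<close>).  The last piece needed is that the matrices of
  rank at most \<open>r\<close> form a closed set (\<open>closed_rank_le\<close>).
\<close>

section \<open>Spectral theorem for real symmetric matrices\<close>

text \<open>
  The eigenvector is a maximiser of the quadratic form \<open>x \<bullet> f x\<close> on the unit sphere of \<open>S\<close>.  Moving
  from it in a direction \<open>w\<close> orthogonal to it changes the form to first order by a multiple of \<open>f v \<bullet> w\<close>, so
  this product vanishes, and \<open>f v\<close> has no component outside the line of \<open>v\<close>.
\<close>
lemma self_adjoint_unit_eigenvector:
  fixes f :: "'a::euclidean_space \<Rightarrow> 'a"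
  assumes f: "linear f" "\<And>x y. f x \<bullet> y = x \<bullet> f y"
    and S: "subspace S" "f ` S \<subseteq> S" "S \<noteq> {0}"
  obtains v c where "v \<in> S" "norm v = 1" "f v = c *\<^sub>R v"
proof -
  let ?C = "S \<inter> sphere 0 1"
  have "compact ?C"
    by (intro closed_Int_compact closed_subspace S compact_sphere)
  moreover have "?C \<noteq> {}"
  proof -
    obtain x where "x \<in> S" "x \<noteq> 0"
      using S(1,3) subspace_0 by blast
    then have "(1 / norm x) *\<^sub>R x \<in> ?C"
      using S(1) by (simp add: subspace_scale)
    then show ?thesis by blast
  qed
  moreover have "continuous_on ?C (\<lambda>x. x \<bullet> f x)"
    by (intro continuous_intros linear_continuous_on f(1)) (use f(1) linear_conv_bounded_linear in blast)
  ultimately obtain v where v: "v \<in> ?C" and max: "\<And>x. x \<in> ?C \<Longrightarrow> x \<bullet> f x \<le> v \<bullet> f v"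
    using continuous_attains_sup by metis
  have vS: "v \<in> S" and v1: "norm v = 1" and vv: "v \<bullet> v = 1"
    using v by (auto simp: norm_eq_1)
  define c where "c = v \<bullet> f v"
  have quad: "x \<bullet> f x \<le> c * (x \<bullet> x)" if "x \<in> S" for x
  proof (cases "x = 0")
    case False
    then have "(1 / norm x) *\<^sub>R x \<in> ?C"
      using that S(1) by (simp add: subspace_scale)
    from max[OF this] have "(x \<bullet> f x) / (norm x)\<^sup>2 \<le> c"
      by (simp add: linear_cmul[OF f(1)] c_def power2_eq_square)
    then show ?thesis
      using False by (simp add: divide_le_eq power2_norm_eq_inner)
  qed (simp add: linear_0[OF f(1)])
  have orth: "f v \<bullet> w = 0" if "w \<in> S" "v \<bullet> w = 0" for w
  proof -
    define p where "p = f v \<bullet> w"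
    define q where "q = w \<bullet> f w - c * (w \<bullet> w)"
    \<comment> \<open>The step length makes the linear term outweigh the quadratic one, which is at most \<open>\<bar>q\<bar> * t\<^sup>2\<close> in size.\<close>
    define r where "r = \<bar>q\<bar> + 1"
    define t where "t = p / r"
    have "v + t *\<^sub>R w \<in> S"
      using S(1) vS that(1) by (simp add: subspace_add subspace_scale)
    from quad[OF this] have "2 * t * p + t\<^sup>2 * q \<le> 0"
      using that(2) f(2)[of v w] f(2)[of w v]
      by (simp add: linear_add[OF f(1)] linear_cmul[OF f(1)] inner_add_left inner_add_right
          inner_commute[of w v] inner_commute[of w "f v"] vv c_def[symmetric] p_def q_def power2_eq_square algebra_simps)
    then have "(2 * t * p + t\<^sup>2 * q) * r\<^sup>2 \<le> 0"
      by (simp add: mult_nonpos_nonneg)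
    moreover have p: "p = t * r"
      by (simp add: t_def r_def)
    have "(2 * t * p + t\<^sup>2 * q) * r\<^sup>2 = p\<^sup>2 * (2 * r + q)"
      unfolding p by (simp add: power2_eq_square algebra_simps)
    ultimately have "p\<^sup>2 * (2 * r + q) \<le> 0" by simp
    moreover have "2 * r + q > 0"
      by (cases "q \<ge> 0") (simp_all add: r_def)
    ultimately have "p\<^sup>2 \<le> 0"
      by (simp add: mult_le_0_iff)
    then show ?thesis by (simp add: p_def)
  qed
  define w where "w = f v - c *\<^sub>R v"
  have wS: "w \<in> S"
    unfolding w_def using S vS by (intro subspace_diff subspace_scale) auto
  have vw: "v \<bullet> w = 0"
    by (simp add: w_def c_def inner_diff_right vv)
  have "w \<bullet> w = f v \<bullet> w - c * (v \<bullet> w)"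
    by (simp add: w_def inner_diff_left)
  then have "w = 0"
    using orth[OF wS vw] vw by simp
  then show ?thesis
    using that vS v1 by (simp add: w_def)
qed

text \<open>
  A self-adjoint map leaves the orthogonal complement of an eigenvector invariant, so eigenvectors
  can be split off one at a time.
\<close>
lemma self_adjoint_orthonormal_eigenbasis:
  fixes f :: "'a::euclidean_space \<Rightarrow> 'a"
  assumes f: "linear f" "\<And>x y. f x \<bullet> y = x \<bullet> f y"
    and S: "subspace S" "f ` S \<subseteq> S"
  shows "\<exists>B \<subseteq> S. finite B \<and> card B = dim S \<and> pairwise orthogonal B \<and> (\<forall>v\<in>B. norm v = 1 \<and> (\<exists>c. f v = c *\<^sub>R v))"
  using S
proof (induction "dim S" arbitrary: S)
  case 0
  then show ?case by (intro exI[of _ "{}"]) auto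
next
  case (Suc n)
  then have "S \<noteq> {0}" by auto
  then obtain v c where v: "v \<in> S" "norm v = 1" "f v = c *\<^sub>R v"
    using self_adjoint_unit_eigenvector[OF f Suc.prems] by blast
  define T where "T = {y \<in> S. \<forall>x \<in> span {v}. orthogonal x y}"
  have T_eq: "T = {y \<in> S. v \<bullet> y = 0}"
    by (auto simp: T_def span_singleton orthogonal_def)
  have "dim T + dim (span {v}) = dim S"
    unfolding T_def using v(1) Suc.prems(1)
    by (intro dim_subspace_orthogonal_to_vectors) (auto simp: span_minimal)
  moreover have "dim (span {v}) = 1"
    using v(2) by (auto simp: dim_insert)
  ultimately have dT: "n = dim T"
    using Suc.hyps(2) by simp
  have "subspace T"
    unfolding T_eq using Suc.prems(1)
    by (auto simp: subspace_def inner_add_right)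
  moreover have "f ` T \<subseteq> T"
  proof -
    have "v \<bullet> f y = 0" if "v \<bullet> y = 0" for y
      using f(2)[of v y] v(3) that by simp
    then show ?thesis
      using Suc.prems(2) by (auto simp: T_eq)
  qed
  ultimately obtain B where B: "B \<subseteq> T" "finite B" "card B = n" "pairwise orthogonal B"
      "\<forall>v\<in>B. norm v = 1 \<and> (\<exists>c. f v = c *\<^sub>R v)"
    using Suc.hyps(1)[OF dT] dT by auto
  have "v \<notin> B"
    using B(1) v(2) by (auto simp: T_eq norm_eq_1)
  then show ?case
    using B v Suc.hyps(2)
    by (intro exI[of _ "insert v B"])
       (auto simp: T_eq pairwise_insert orthogonal_def inner_commute subset_iff)
qed

abbreviation diag_matrix :: "('n \<Rightarrow> real) \<Rightarrow> real^'n^'n" where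
  "diag_matrix d \<equiv> \<chi> i j. if i = j then d i else 0"

lemma matrix_mult_diag: "(A ** diag_matrix d) $ i $ j = A $ i $ j * d j"
  by (simp add: matrix_matrix_mult_def if_distrib cong: if_cong)

lemma diag_matrix_mult: "(diag_matrix d ** A) $ i = d i *\<^sub>R A $ i"
proof -
  have "(diag_matrix d ** A) $ i $ j = d i * A $ i $ j" for j
    by (simp add: matrix_matrix_mult_def if_distrib[of "\<lambda>x. x * y" for y] cong: if_cong)
  then show ?thesis by (simp add: vec_eq_iff)
qed

theorem symmetric_matrix_diagonalization:
  fixes A :: "real^'n^'n"
  assumes "transpose A = A"
  obtains Q d where "orthogonal_matrix Q" "A = Q ** diag_matrix d ** transpose Q"
proof -
  have "(A *v x) \<bullet> y = x \<bullet> (A *v y)" for x y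
    by (metis assms dot_lmul_matrix transpose_matrix_vector)
  then obtain B where B: "finite B" "card B = CARD('n)" "pairwise orthogonal B"
      "\<forall>v\<in>B. norm v = 1 \<and> (\<exists>c. A *v v = c *\<^sub>R v)"
    using self_adjoint_orthonormal_eigenbasis[of "(*v) A" UNIV] by auto
  obtain b where b: "bij_betw b (UNIV :: 'n set) B"
    using finite_same_card_bij[of "UNIV :: 'n set" B] B(1,2) by auto
  have "\<exists>c. A *v b j = c *\<^sub>R b j" for j
    using B(4) b bij_betwE by blast
  then obtain d where d: "\<And>j. A *v b j = d j *\<^sub>R b j"
    by metis
  define Q :: "real^'n^'n" where "Q = (\<chi> i j. b j $ i)"
  have col: "column j Q = b j" for j
    by (simp add: Q_def column_def)
  have "orthogonal_matrix Q"
    unfolding orthogonal_matrix_orthonormal_columns col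
    using B(3,4) b unfolding pairwise_def bij_betw_def inj_on_def by (metis UNIV_I rangeI)
  moreover have "A ** Q = Q ** diag_matrix d"
  proof -
    have "(A ** Q) $ i $ j = (A *v b j) $ i" for i j
      by (simp add: Q_def matrix_matrix_mult_def matrix_vector_mult_def)
    then show ?thesis
      by (simp add: vec_eq_iff matrix_mult_diag d) (simp add: Q_def)
  qed
  ultimately show ?thesis
    using that[of Q d] by (metis matrix_mul_assoc matrix_mul_rid orthogonal_matrix_def)
qed

lemma matrix_diff_left: "(A - B) ** C = A ** C - B ** C" for A B :: "real^'m^'n"
  by (simp add: matrix_matrix_mult_def vec_eq_iff left_diff_distrib sum_subtractf)

lemma matrix_diff_right: "C ** (A - B) = C ** A - C ** B" for A B :: "real^'m^'n"
  by (simp add: matrix_matrix_mult_def vec_eq_iff right_diff_distrib sum_subtractf)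

text \<open>
  Evaluating at a real number moves the computation of a characteristic polynomial from
  matrices over the polynomial ring to real matrices.
\<close>
lemma poly_charpoly: "poly (charpoly A) x = det (mat x - A)"
  by (simp add: charpoly_def det_def poly_sum poly_prod poly_monom mat_def if_distrib[of "\<lambda>p. poly p x"] cong: if_cong)

lemma charpoly_orthogonal_diag:
  assumes "orthogonal_matrix Q"
  shows "charpoly (Q ** diag_matrix d ** transpose Q) = (\<Prod>i\<in>UNIV. [:- d i, 1:])"
proof -
  have "poly (charpoly (Q ** diag_matrix d ** transpose Q)) x = poly (\<Prod>i\<in>UNIV. [:- d i, 1:]) x" for x
  proof -
    have "mat x - Q ** diag_matrix d ** transpose Q = Q ** diag_matrix (\<lambda>i. x - d i) ** transpose Q"
    proof -
      have "diag_matrix (\<lambda>i. x - d i) = x *\<^sub>R mat 1 - diag_matrix d"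
        by (simp add: vec_eq_iff mat_def)
      moreover have "mat x = x *\<^sub>R (mat 1 :: real^'a^'a)"
        by (simp add: vec_eq_iff mat_def)
      ultimately show ?thesis
        using assms unfolding orthogonal_matrix_def
        by (simp add: matrix_diff_left matrix_diff_right matrix_scalar_ac flip: scalar_matrix_assoc)
    qed
    then have "det (mat x - Q ** diag_matrix d ** transpose Q) = det (diag_matrix (\<lambda>i. x - d i)) * det (Q ** transpose Q)"
      by (simp add: det_mul mult_ac)
    also have "\<dots> = (\<Prod>i\<in>UNIV. x - d i)"
      using assms unfolding orthogonal_matrix_def by (simp add: det_diagonal)
    finally show ?thesis
      by (simp add: poly_charpoly poly_prod)
  qed
  then show ?thesis
    by (simp add: poly_eq_poly_eq_iff[symmetric] fun_eq_iff)
qed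

section \<open>Singular values as row norms\<close>

definition orthogonal_rows :: "real^'m^'n \<Rightarrow> bool" where
  "orthogonal_rows B \<longleftrightarrow> (\<forall>i j. i \<noteq> j \<longrightarrow> B $ i \<bullet> B $ j = 0)"

lemma orthogonal_rows_gram:
  assumes "orthogonal_rows B"
  shows "B ** transpose B = diag_matrix (\<lambda>i. (norm (B $ i))\<^sup>2)"
  using assms
  by (simp add: matrix_mult_transpose_dot_row row_def orthogonal_rows_def vec_eq_iff power2_norm_eq_inner)

lemma gram_diag_imp_orthogonal_rows:
  assumes "B ** transpose B = diag_matrix d"
  shows "orthogonal_rows B"
  using assms
  by (simp add: matrix_mult_transpose_dot_row row_def orthogonal_rows_def vec_eq_iff)

lemma transpose_diag_matrix: "transpose (diag_matrix d) = diag_matrix d"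
  by (simp add: transpose_def vec_eq_iff)

text \<open>
  In the usual notation \<open>A = U \<Sigma> V\<^sup>T\<close>, the factor \<open>Q\<close> is \<open>U\<close> and \<open>B\<close> is
  \<open>\<Sigma> V\<^sup>T\<close>.  Leaving the right singular vectors unnormalised, with rows 0 for the zero singular values,
  avoids completing them to an orthonormal family.  The columns of \<open>Q\<close> diagonalise
  \<open>A ** transpose A\<close>.
\<close>
lemma singular_value_decomposition:
  fixes A :: "real^'m^'n"
  obtains Q B where "orthogonal_matrix Q" "orthogonal_rows B" "A = Q ** B"
proof -
  have "transpose (A ** transpose A) = A ** transpose A"
    by (simp only: matrix_transpose_mul transpose_transpose)
  then obtain Q d where Q: "orthogonal_matrix Q" and eq: "A ** transpose A = Q ** diag_matrix d ** transpose Q"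
    by (rule symmetric_matrix_diagonalization)
  let ?B = "transpose Q ** A"
  have "?B ** transpose ?B = transpose Q ** (A ** transpose A) ** Q"
    by (simp add: matrix_transpose_mul matrix_mul_assoc)
  also have "\<dots> = (transpose Q ** Q) ** diag_matrix d ** (transpose Q ** Q)"
    by (simp add: eq matrix_mul_assoc)
  also have "\<dots> = diag_matrix d"
    using Q by (simp add: orthogonal_matrix_def)
  finally have "orthogonal_rows ?B"
    by (rule gram_diag_imp_orthogonal_rows)
  moreover have "A = Q ** ?B"
    using Q by (simp add: orthogonal_matrix_def matrix_mul_assoc)
  ultimately show ?thesis using that Q by blast
qed

text \<open>
  For symmetric \<open>A = Q ** diag_matrix d ** transpose Q\<close>, the spectral decomposition is thus already a
  singular value decomposition, with \<open>B = diag_matrix d ** transpose Q\<close>.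
\<close>
lemma orthogonal_rows_diag_transpose:
  assumes "orthogonal_matrix Q"
  shows "orthogonal_rows (diag_matrix d ** transpose Q)"
proof (rule gram_diag_imp_orthogonal_rows)
  have "diag_matrix d ** transpose Q ** transpose (diag_matrix d ** transpose Q)
      = diag_matrix d ** (transpose Q ** Q) ** diag_matrix d"
    by (simp add: matrix_transpose_mul transpose_diag_matrix matrix_mul_assoc)
  also have "\<dots> = diag_matrix d ** diag_matrix d"
    using assms by (simp add: orthogonal_matrix_def)
  also have "\<dots> = diag_matrix (\<lambda>i. d i * d i)"
    by (simp add: vec_eq_iff diag_matrix_mult)
  finally show "diag_matrix d ** transpose Q ** transpose (diag_matrix d ** transpose Q)
      = diag_matrix (\<lambda>i. d i * d i)" .
qed

text \<open>
  The characteristic polynomial of \<open>Q ** B ** transpose (Q ** B)\<close> has the squared row norms of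
  \<open>B\<close> as its roots, with multiplicity.  The enumeration \<open>e\<close> lists the row indices by nonincreasing
  row norm.
\<close>
lemma singular_values_row_norms:
  fixes B :: "real^'m^'n"
  assumes Q: "orthogonal_matrix Q" and B: "orthogonal_rows B"
  obtains e where "bij_betw e {1..CARD('n)} UNIV"
    "\<forall>i\<in>{1..CARD('n)}. sing_val (Q ** B) i = norm (B $ e i)"
    "antimono_on {1..CARD('n)} (sing_val (Q ** B))"
proof -
  let ?f = "\<lambda>i. norm (B $ i)"
  have "(Q ** B) ** transpose (Q ** B) = Q ** (B ** transpose B) ** transpose Q"
    by (simp only: matrix_transpose_mul matrix_mul_assoc)
  then have "proots (charpoly ((Q ** B) ** transpose (Q ** B))) = (\<Sum>i\<in>UNIV. {#(?f i)\<^sup>2#})"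
    by (simp add: orthogonal_rows_gram[OF B] charpoly_orthogonal_diag[OF Q] proots_prod)
  then have mset: "image_mset sqrt (proots (charpoly ((Q ** B) ** transpose (Q ** B)))) = image_mset ?f (mset_set UNIV)"
    by (simp add: sum_unfold_sum_mset multiset.map_comp comp_def)
  obtain ys :: "'n list" where ys: "set ys = UNIV" "distinct ys"
    using finite_distinct_list[OF finite_class.finite_UNIV] by blast
  define xs where "xs = rev (sort_key ?f ys)"
  have xs: "set xs = UNIV" "distinct xs" and len: "length xs = CARD('n)"
    using ys by (simp_all add: xs_def flip: distinct_card)
  have "sort (map ?f ys) = map ?f (sort_key ?f ys)"
    by (rule properties_for_sort) simp_all
  then have map_xs: "map ?f xs = rev (sort (map ?f ys))"
    by (simp add: xs_def rev_map)
  moreover have "mset_set (UNIV :: 'n set) = mset ys"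
    using mset_set_set[OF ys(2)] ys(1) by simp
  then have "image_mset ?f (mset_set UNIV) = mset (map ?f ys)"
    by simp
  ultimately have sv: "singular_values (Q ** B) = map ?f xs"
    unfolding singular_values_def mset by (simp only: sorted_list_of_multiset_mset)
  have dec: "sorted_wrt (\<ge>) (map ?f xs)"
    unfolding map_xs sorted_wrt_rev by (rule sorted_sort)
  show ?thesis
  proof
    have "bij_betw (\<lambda>i. i - 1) {1..CARD('n)} {..<CARD('n)}"
      by (rule bij_betw_byWitness[of _ Suc]) auto
    moreover have "bij_betw ((!) xs) {..<CARD('n)} UNIV"
      by (rule bij_betw_nth) (simp_all add: xs len)
    ultimately have "bij_betw ((!) xs \<circ> (\<lambda>i. i - 1)) {1..CARD('n)} UNIV"
      by (rule bij_betw_trans)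
    then show "bij_betw (\<lambda>i. xs ! (i - 1)) {1..CARD('n)} UNIV"
      by (simp only: comp_def)
    have nth: "sing_val (Q ** B) i = norm (B $ (xs ! (i - 1)))" if "1 \<le> i" "i \<le> CARD('n)" for i
    proof -
      have "i - 1 < length xs" using that len by linarith
      then show ?thesis unfolding sing_val_def sv by (rule nth_map)
    qed
    then show "\<forall>i\<in>{1..CARD('n)}. sing_val (Q ** B) i = norm (B $ (xs ! (i - 1)))"
      by simp
    have "sing_val (Q ** B) j \<le> sing_val (Q ** B) i" if "1 \<le> i" "i \<le> j" "j \<le> CARD('n)" for i j
    proof (cases "i = j")
      case False
      then have "i - 1 < j - 1" "j - 1 < length (map ?f xs)"
        using that len by auto
      from sorted_wrt_nth_less[OF dec this] show ?thesis
        unfolding sing_val_def sv .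
    qed simp
    then show "antimono_on {1..CARD('n)} (sing_val (Q ** B))"
      by (simp add: monotone_on_def)
  qed
qed

lemma sing_val_nonneg:
  fixes A :: "real^'m^'n"
  assumes i: "i \<in> {1..CARD('n)}"
  shows "0 \<le> sing_val A i"
proof -
  obtain Q and B :: "real^'m^'n" where QB: "orthogonal_matrix Q" "orthogonal_rows B" "A = Q ** B"
    by (rule singular_value_decomposition)
  obtain e where "\<forall>i\<in>{1..CARD('n)}. sing_val A i = norm (B $ e i)"
    by (rule singular_values_row_norms[OF QB(1,2), folded QB(3)])
  then show ?thesis
    using i by simp
qed

lemma antimono_sing_val:
  fixes A :: "real^'m^'n"
  shows "antimono_on {1..CARD('n)} (sing_val A)"
proof -
  obtain Q and B :: "real^'m^'n" where QB: "orthogonal_matrix Q" "orthogonal_rows B" "A = Q ** B"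
    by (rule singular_value_decomposition)
  show ?thesis
    by (rule singular_values_row_norms[OF QB(1,2), folded QB(3)])
qed

lemma sing_val_antimono:
  fixes A :: "real^'m^'n"
  assumes "1 \<le> i" "i \<le> j" "j \<le> CARD('n)"
  shows "sing_val A j \<le> sing_val A i"
  using antimono_sing_val[of A] assms by (simp add: monotone_on_def)

lemma rank_orthogonal_mult:
  fixes B :: "real^'m^'n"
  assumes "orthogonal_matrix Q"
  shows "rank (Q ** B) = rank B"
proof (rule antisym)
  have "B = transpose Q ** (Q ** B)"
    using assms by (simp add: orthogonal_matrix_def matrix_mul_assoc)
  then show "rank B \<le> rank (Q ** B)"
    using rank_mul_le_right[of "transpose Q" "Q ** B"] by simp
qed (rule rank_mul_le_right)

lemma rank_le_card_nonzero_rows: "rank B \<le> card {i. B $ i \<noteq> 0}" for B :: "real^'m^'n"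
proof -
  have "rank B = dim (rows B)" by (rule row_rank_def)
  also have "rows B \<subseteq> insert 0 (($) B ` {i. B $ i \<noteq> 0})"
    by (auto simp: rows_def row_def)
  then have "dim (rows B) \<le> dim (insert 0 (($) B ` {i. B $ i \<noteq> 0}))"
    by (rule dim_subset)
  also have "\<dots> = dim (($) B ` {i. B $ i \<noteq> 0})"
    by (subst (1 2) dim_span[symmetric]) (simp only: span_insert_0)
  also have "\<dots> \<le> card (($) B ` {i. B $ i \<noteq> 0})"
    by (rule dim_le_card) (simp_all add: span_superset)
  also have "\<dots> \<le> card {i. B $ i \<noteq> 0}"
    by (rule card_image_le) simp
  finally show ?thesis .
qed

lemma rank_orthogonal_rows:
  fixes B :: "real^'m^'n"
  assumes "orthogonal_rows B"
  shows "rank B = card {i. B $ i \<noteq> 0}"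
proof (rule antisym[OF rank_le_card_nonzero_rows])
  let ?J = "{i. B $ i \<noteq> 0}"
  have orth: "B $ i \<bullet> B $ j = 0" if "i \<noteq> j" for i j
    using assms that by (simp add: orthogonal_rows_def)
  have "inj_on (($) B) ?J"
  proof (rule inj_onI)
    fix i j assume "i \<in> ?J" "B $ i = B $ j"
    then have "B $ i \<bullet> B $ j \<noteq> 0" by simp
    then show "i = j" using orth by blast
  qed
  then have "card ?J = card (($) B ` ?J)"
    by (simp add: card_image)
  moreover have "pairwise orthogonal (($) B ` ?J)"
  proof (rule pairwiseI)
    fix x y assume "x \<in> ($) B ` ?J" "y \<in> ($) B ` ?J" and xy: "x \<noteq> y"
    then obtain i j where "x = B $ i" "y = B $ j" by (elim imageE)
    with xy show "orthogonal x y"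
      unfolding orthogonal_def using orth[of i j] by fastforce
  qed
  then have "independent (($) B ` ?J)"
    by (rule pairwise_orthogonal_independent) auto
  then have "card (($) B ` ?J) \<le> dim (rows B)"
    by (intro independent_card_le_dim) (auto simp: rows_def row_def)
  ultimately show "card ?J \<le> rank B"
    by (simp add: row_rank_def)
qed

text \<open>
  The Frobenius norm is determined by the Gram matrix \<open>transpose B ** B\<close>, in which \<open>Q\<close> cancels.
\<close>
lemma norm_orthogonal_mult:
  fixes B :: "real^'m^'n"
  assumes "orthogonal_matrix Q"
  shows "norm (Q ** B) = norm B"
proof -
  have fro: "(norm M)\<^sup>2 = trace (transpose M ** M)" for M :: "real^'m^'n"
    unfolding power2_norm_eq_inner trace_def matrix_mult_transpose_dot_column inner_vec_def column_def
    by simp (rule sum.swap)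
  have "transpose (Q ** B) ** (Q ** B) = transpose B ** (transpose Q ** Q) ** B"
    by (simp add: matrix_transpose_mul matrix_mul_assoc)
  also have "\<dots> = transpose B ** B"
    using assms by (simp add: orthogonal_matrix_def)
  finally have "(norm (Q ** B))\<^sup>2 = (norm B)\<^sup>2"
    by (simp add: fro)
  then show ?thesis by simp
qed

section \<open>The truncation residual\<close>

lemma nuclear_minus_ky_fan:
  fixes A :: "real^'m^'n"
  assumes "r \<le> CARD('n)"
  shows "nuclear_norm A - ky_fan_norm r A = (\<Sum>i = r + 1..CARD('n). sing_val A i)"
proof -
  have "{1..CARD('n)} = {1..r} \<union> {r + 1..CARD('n)}"
    using assms by auto
  then have "nuclear_norm A = (\<Sum>i \<in> {1..r} \<union> {r + 1..CARD('n)}. sing_val A i)"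
    unfolding nuclear_norm_def by (rule arg_cong)
  also have "\<dots> = ky_fan_norm r A + (\<Sum>i = r + 1..CARD('n). sing_val A i)"
    unfolding ky_fan_norm_def by (rule sum.union_disjoint) auto
  finally show ?thesis by simp
qed

lemma nuclear_minus_ky_fan_nonneg:
  fixes A :: "real^'m^'n"
  assumes "r \<le> CARD('n)"
  shows "0 \<le> nuclear_norm A - ky_fan_norm r A"
  unfolding nuclear_minus_ky_fan[OF assms] by (intro sum_nonneg sing_val_nonneg) auto

text \<open>
  \<open>J\<close> consists of the indices of \<open>r\<close> largest rows of \<open>B\<close>.  The discarded rows have as norms
  the singular values after the \<open>r\<close>-th one, and the Frobenius norm is at most the sum of the row norms.
\<close>
lemma row_truncation:
  fixes B :: "real^'m^'n"
  assumes r: "r \<le> CARD('n)" and Q: "orthogonal_matrix Q" and B: "orthogonal_rows B"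
  obtains J where "rank (Q ** (diag_matrix (indicator J) ** B)) \<le> r"
    "norm (Q ** B - Q ** (diag_matrix (indicator J) ** B)) \<le> nuclear_norm (Q ** B) - ky_fan_norm r (Q ** B)"
proof -
  obtain e where e: "bij_betw e {1..CARD('n)} UNIV"
    and sv: "\<forall>i\<in>{1..CARD('n)}. sing_val (Q ** B) i = norm (B $ e i)"
    by (rule singular_values_row_norms[OF Q B])
  define J where "J = e ` {1..r}"
  let ?T = "diag_matrix (indicator J) ** B"
  have inj: "inj_on e {1..CARD('n)}" and img: "e ` {1..CARD('n)} = UNIV"
    using e by (auto simp: bij_betw_def)
  have J: "- J = e ` {r + 1..CARD('n)}"
  proof -
    have "{1..CARD('n)} - {1..r} = {r + 1..CARD('n)}" by auto
    then have "e ` {1..CARD('n)} - J = e ` {r + 1..CARD('n)}"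
      using inj_on_image_set_diff[OF inj, of "{1..CARD('n)}" "{1..r}"] r by (simp add: J_def)
    then show ?thesis using img by auto
  qed
  show ?thesis
  proof
    have "rank (Q ** ?T) = rank ?T"
      by (rule rank_orthogonal_mult[OF Q])
    also have "\<dots> \<le> card {i. ?T $ i \<noteq> 0}"
      by (rule rank_le_card_nonzero_rows)
    also have "\<dots> \<le> card J"
      by (intro card_mono) (auto simp: diag_matrix_mult indicator_def split: if_splits)
    also have "\<dots> \<le> r"
      unfolding J_def using card_image_le[of "{1..r}" e] by simp
    finally show "rank (Q ** ?T) \<le> r" .
    have "norm (Q ** B - Q ** ?T) = norm (B - ?T)"
      by (simp add: norm_orthogonal_mult[OF Q] flip: matrix_diff_right)
    also have "\<dots> \<le> (\<Sum>i\<in>UNIV. norm ((B - ?T) $ i))"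
      unfolding norm_vec_def by (rule L2_set_le_sum) simp
    also have "\<dots> = (\<Sum>i\<in>UNIV. if i \<in> - J then norm (B $ i) else 0)"
      by (intro sum.cong) (auto simp: diag_matrix_mult indicator_def)
    also have "\<dots> = (\<Sum>i\<in>- J. norm (B $ i))"
      by (simp only: sum.inter_restrict[symmetric] finite_class.finite_UNIV Int_UNIV_left)
    also have "\<dots> = (\<Sum>i = r + 1..CARD('n). norm (B $ e i))"
      unfolding J by (subst sum.reindex) (auto intro: inj_on_subset[OF inj])
    also have "\<dots> = (\<Sum>i = r + 1..CARD('n). sing_val (Q ** B) i)"
      by (intro sum.cong) (auto simp: sv)
    also have "\<dots> = nuclear_norm (Q ** B) - ky_fan_norm r (Q ** B)"
      by (rule nuclear_minus_ky_fan[OF r, symmetric])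
    finally show "norm (Q ** B - Q ** ?T) \<le> nuclear_norm (Q ** B) - ky_fan_norm r (Q ** B)" .
  qed
qed

text \<open>
  The rank is the number of nonzero singular values, and these come first in the list.
\<close>
lemma rank_le_iff_nuclear_eq_ky_fan:
  fixes A :: "real^'m^'n"
  assumes r: "r \<le> CARD('n)"
  shows "nuclear_norm A - ky_fan_norm r A = 0 \<longleftrightarrow> rank A \<le> r"
proof -
  obtain Q and B :: "real^'m^'n" where QB: "orthogonal_matrix Q" "orthogonal_rows B" and A: "A = Q ** B"
    by (rule singular_value_decomposition)
  obtain e where e: "bij_betw e {1..CARD('n)} UNIV"
    and sv: "\<forall>i\<in>{1..CARD('n)}. sing_val A i = norm (B $ e i)"
    by (rule singular_values_row_norms[OF QB, folded A])
  show ?thesis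
  proof
    assume K: "nuclear_norm A - ky_fan_norm r A = 0"
    obtain J where rank: "rank (Q ** (diag_matrix (indicator J) ** B)) \<le> r"
      and "norm (A - Q ** (diag_matrix (indicator J) ** B)) \<le> nuclear_norm A - ky_fan_norm r A"
      by (rule row_truncation[OF r QB, folded A])
    then have "A = Q ** (diag_matrix (indicator J) ** B)"
      unfolding K by simp
    then show "rank A \<le> r"
      using rank by simp
  next
    assume "rank A \<le> r"
    then have card: "card {i. B $ i \<noteq> 0} \<le> r"
      unfolding A by (simp add: rank_orthogonal_mult[OF QB(1)] rank_orthogonal_rows[OF QB(2)])
    have "sing_val A i = 0" if i: "i \<in> {r + 1..CARD('n)}" for i
    proof (rule ccontr)
      assume nz: "sing_val A i \<noteq> 0"
      have "B $ e j \<noteq> 0" if j: "j \<in> {1..i}" for j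
      proof
        assume "B $ e j = 0"
        then have "sing_val A j = 0" using sv i j by simp
        moreover have "sing_val A i \<le> sing_val A j"
          using i j by (intro sing_val_antimono) auto
        ultimately show False
          using nz sing_val_nonneg[of i A] i by simp
      qed
      then have "card (e ` {1..i}) \<le> card {i. B $ i \<noteq> 0}"
        by (intro card_mono) auto
      moreover have "inj_on e {1..i}"
        using bij_betw_imp_inj_on[OF e] by (rule inj_on_subset) (use i in auto)
      then have "card (e ` {1..i}) = i"
        by (simp add: card_image)
      ultimately show False using card i by simp
    qed
    then show "nuclear_norm A - ky_fan_norm r A = 0"
      unfolding nuclear_minus_ky_fan[OF r] by simp
  qed
qed

text \<open>
  With \<open>a\<close> the \<open>r\<close>-th singular value, \<open>b\<close> the sum and \<open>q\<close> the sum of squares of the later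
  ones, the claim reads \<open>b / 2 \<le> a + b - sqrt (a\<^sup>2 + q) \<le> b\<close>.  As no later singular value exceeds
  \<open>a\<close>, one has \<open>q \<le> a * b\<close>, hence \<open>a\<^sup>2 + q \<le> (a + b / 2)\<^sup>2\<close>.
\<close>
lemma nuclear_minus_H_bounds:
  fixes A :: "real^'m^'n"
  assumes r: "r \<in> {1..CARD('n)}"
  shows "nuclear_norm A - H_fun r A \<le> nuclear_norm A - ky_fan_norm r A" (is "?T \<le> ?K")
    and "nuclear_norm A - ky_fan_norm r A \<le> 2 * (nuclear_norm A - H_fun r A)"
proof -
  define a where "a = sing_val A r"
  define b where "b = (\<Sum>i = r + 1..CARD('n). sing_val A i)"
  define q where "q = (\<Sum>i = r + 1..CARD('n). (sing_val A i)\<^sup>2)"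
  have K: "?K = b"
    using r nuclear_minus_ky_fan[of r A] by (simp add: b_def)
  have split: "{1..CARD('n)} = {1..r - 1} \<union> insert r {r + 1..CARD('n)}"
    "{r..CARD('n)} = insert r {r + 1..CARD('n)}"
    using r by auto
  have disj: "{1..r - 1} \<inter> insert r {r + 1..CARD('n)} = {}"
    using r by auto
  have "nuclear_norm A = (\<Sum>i = 1..r - 1. sing_val A i) + (a + b)"
    unfolding nuclear_norm_def split(1) a_def b_def
    by (subst sum.union_disjoint) (use disj in auto)
  moreover have "(\<Sum>i = r..CARD('n). (sing_val A i)\<^sup>2) = a\<^sup>2 + q"
    unfolding split(2) a_def q_def by simp
  ultimately have T: "?T = a + b - sqrt (a\<^sup>2 + q)"
    by (simp add: H_fun_def)
  have a: "0 \<le> a" and b: "0 \<le> b" and q: "0 \<le> q"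
    using r by (auto simp: a_def b_def q_def intro!: sing_val_nonneg sum_nonneg)
  have "q \<le> (\<Sum>i = r + 1..CARD('n). a * sing_val A i)"
    unfolding q_def power2_eq_square a_def
    using r by (intro sum_mono mult_right_mono sing_val_antimono sing_val_nonneg) auto
  then have qab: "q \<le> a * b"
    by (simp add: b_def sum_distrib_left)
  have "a \<le> sqrt (a\<^sup>2 + q)"
    using q by (intro real_le_rsqrt) simp
  then show "?T \<le> ?K"
    unfolding T K by simp
  have "sqrt (a\<^sup>2 + q) \<le> a + b / 2"
  proof (rule real_le_lsqrt)
    have "(a + b / 2)\<^sup>2 = a\<^sup>2 + a * b + (b / 2)\<^sup>2"
      by (simp add: power2_eq_square algebra_simps)
    then show "a\<^sup>2 + q \<le> (a + b / 2)\<^sup>2"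
      using qab zero_le_power2[of "b / 2"] by linarith
  qed (use a b in simp)
  then show "?K \<le> 2 * ?T"
    unfolding T K by simp
qed

section \<open>Closedness of, and distance to, the low-rank matrices\<close>

lemma compact_orthogonal_matrices: "compact {Q :: real^'n^'n. orthogonal_matrix Q}"
proof -
  have "{Q :: real^'n^'n. orthogonal_matrix Q} =
      {Q. \<forall>i j. (\<Sum>k\<in>UNIV. Q $ k $ i * Q $ k $ j) = (if i = j then 1 else 0)}"
    by (simp add: orthogonal_matrix matrix_matrix_mult_def transpose_def mat_def vec_eq_iff)
  moreover have "closed \<dots>"
    by (intro closed_Collect_all closed_Collect_eq continuous_intros)
  moreover have "norm Q \<le> CARD('n)" if "orthogonal_matrix Q" for Q :: "real^'n^'n"
  proof -
    have "norm Q \<le> (\<Sum>i\<in>UNIV. norm (Q $ i))"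
      unfolding norm_vec_def by (rule L2_set_le_sum) simp
    also have "\<dots> = CARD('n)"
      using that by (simp add: orthogonal_matrix_orthonormal_rows row_def)
    finally show ?thesis .
  qed
  then have "bounded {Q :: real^'n^'n. orthogonal_matrix Q}"
    by (auto intro: boundedI)
  ultimately show ?thesis
    by (simp add: compact_eq_bounded_closed)
qed

text \<open>
  The rank is at most \<open>r\<close> if and only if multiplication by some orthogonal matrix from the left
  makes all but at most \<open>r\<close> rows equal to 0.  For a given set \<open>J\<close> of surviving rows this is the projection of a closed
  set along the compact set of orthogonal matrices, and there are finitely many sets \<open>J\<close>.
\<close>
lemma closed_rank_le: "closed {A :: real^'m^'n. rank A \<le> r}"
proof -
  define T :: "'n set \<Rightarrow> ((real^'n^'n) \<times> (real^'m^'n)) set" where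
    "T J = {p. \<forall>i\<in>- J. \<forall>j. (\<Sum>k\<in>UNIV. fst p $ k $ i * snd p $ k $ j) = 0}" for J
  have T: "(Q, A) \<in> T J \<longleftrightarrow> (\<forall>i\<in>- J. (transpose Q ** A) $ i = 0)" for Q A J
    by (simp add: T_def matrix_matrix_mult_def transpose_def vec_eq_iff)
  have "closed (T J)" for J
  proof -
    have "T J = (\<Inter>i\<in>- J. {p. \<forall>j. (\<Sum>k\<in>UNIV. fst p $ k $ i * snd p $ k $ j) = 0})"
      by (auto simp: T_def)
    also have "closed \<dots>"
      by (intro closed_INT ballI closed_Collect_all closed_Collect_eq continuous_intros)
    finally show ?thesis .
  qed
  then have "closed {A. \<exists>Q. Q \<in> {Q. orthogonal_matrix Q} \<and> (Q, A) \<in> T J}" for J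
    by (intro closed_compact_projection compact_orthogonal_matrices)
  then have "closed (\<Union>J\<in>{J. card J \<le> r}. {A. \<exists>Q. Q \<in> {Q. orthogonal_matrix Q} \<and> (Q, A) \<in> T J})"
    by (intro closed_UN ballI) auto
  also have "(\<Union>J\<in>{J. card J \<le> r}. {A. \<exists>Q. Q \<in> {Q. orthogonal_matrix Q} \<and> (Q, A) \<in> T J}) = {A. rank A \<le> r}"
  proof (intro equalityI subsetI)
    fix A assume "A \<in> (\<Union>J\<in>{J. card J \<le> r}. {A. \<exists>Q. Q \<in> {Q. orthogonal_matrix Q} \<and> (Q, A) \<in> T J})"
    then obtain J Q where J: "card J \<le> r" and Q: "orthogonal_matrix Q" and QA: "(Q, A) \<in> T J"
      by auto
    have "rank A = rank (transpose Q ** A)"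
      using Q by (simp add: rank_orthogonal_mult)
    also have "\<dots> \<le> card {i. (transpose Q ** A) $ i \<noteq> 0}"
      by (rule rank_le_card_nonzero_rows)
    also have "\<dots> \<le> card J"
      using QA unfolding T by (intro card_mono) auto
    finally show "A \<in> {A. rank A \<le> r}"
      using J by simp
  next
    fix A :: "real^'m^'n" assume A: "A \<in> {A. rank A \<le> r}"
    obtain Q and B :: "real^'m^'n" where Q: "orthogonal_matrix Q" and B: "orthogonal_rows B" and QB: "A = Q ** B"
      by (rule singular_value_decomposition)
    have "card {i. B $ i \<noteq> 0} \<le> r"
      using A by (simp add: QB rank_orthogonal_mult[OF Q] rank_orthogonal_rows[OF B])
    moreover have "transpose Q ** A = B"
      using Q by (simp add: QB orthogonal_matrix_def matrix_mul_assoc)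
    then have "(Q, A) \<in> T {i. B $ i \<noteq> 0}"
      by (simp add: T)
    ultimately show "A \<in> (\<Union>J\<in>{J. card J \<le> r}. {A. \<exists>Q. Q \<in> {Q. orthogonal_matrix Q} \<and> (Q, A) \<in> T J})"
      using Q by blast
  qed
  finally show ?thesis .
qed

lemma closed_low_rank: "closed S \<Longrightarrow> closed (low_rank S r)"
  using closed_Int[OF _ closed_rank_le, of S r] by (simp add: low_rank_def Collect_conj_eq)

lemma subspace_sym_matrices: "subspace (sym_matrices :: (real^'n^'n) set)"
  by (auto simp: subspace_def sym_matrices_def transpose_def vec_eq_iff)

lemma closed_psd_matrices: "closed (psd_matrices :: (real^'n^'n) set)"
proof -
  have "closed {A :: real^'n^'n. \<forall>x. 0 \<le> x \<bullet> (A *v x)}"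
    unfolding matrix_vector_mult_def by (intro closed_Collect_all closed_Collect_le continuous_intros)
  then have "closed (sym_matrices \<inter> {A :: real^'n^'n. \<forall>x. 0 \<le> x \<bullet> (A *v x)})"
    by (intro closed_Int closed_subspace[OF subspace_sym_matrices])
  then show ?thesis
    by (simp add: psd_matrices_def Collect_conj_eq)
qed

lemma infdist_low_rank_le:
  fixes A :: "real^'m^'n"
  assumes r: "r \<le> CARD('n)"
  shows "infdist A (low_rank UNIV r) \<le> nuclear_norm A - ky_fan_norm r A"
proof -
  obtain Q and B :: "real^'m^'n" where QB: "orthogonal_matrix Q" "orthogonal_rows B" and A: "A = Q ** B"
    by (rule singular_value_decomposition)
  obtain J where "rank (Q ** (diag_matrix (indicator J) ** B)) \<le> r"
      "norm (A - Q ** (diag_matrix (indicator J) ** B)) \<le> nuclear_norm A - ky_fan_norm r A"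
    by (rule row_truncation[OF r QB, folded A])
  then show ?thesis
    by (intro infdist_le2) (auto simp: low_rank_def dist_norm)
qed

lemma transpose_orthogonal_conj_diag:
  "transpose (Q ** diag_matrix c ** transpose Q) = Q ** diag_matrix c ** transpose Q"
  by (simp add: matrix_transpose_mul transpose_diag_matrix matrix_mul_assoc)

lemma quadratic_form_conj_diag:
  fixes Q :: "real^'n^'n"
  shows
  "x \<bullet> ((Q ** diag_matrix c ** transpose Q) *v x) = (\<Sum>i\<in>UNIV. c i * ((transpose Q *v x) $ i)\<^sup>2)"
proof -
  have "x \<bullet> ((Q ** diag_matrix c ** transpose Q) *v x) = (transpose Q *v x) \<bullet> (diag_matrix c *v (transpose Q *v x))"
    by (simp add: dot_lmul_matrix flip: matrix_vector_mul_assoc)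
  also have "diag_matrix c *v y = (\<chi> i. c i * y $ i)" for y :: "real^'n"
    by (simp add: matrix_vector_mult_def vec_eq_iff if_distrib[of "\<lambda>x. x * z" for z] cong: if_cong)
  finally show ?thesis
    by (simp add: inner_vec_def power2_eq_square mult_ac)
qed

text \<open>
  Truncating the spectral decomposition replaces some eigenvalues by 0 and keeps the
  eigenvectors.  The truncated matrix is therefore again symmetric, and positive semidefinite if
  \<open>A\<close> is.
\<close>
lemma symmetric_row_truncation:
  fixes A :: "real^'n^'n"
  assumes r: "r \<le> CARD('n)" and A: "A \<in> sym_matrices"
  obtains Q d J where "orthogonal_matrix Q" "A = Q ** diag_matrix d ** transpose Q"
    "rank (Q ** diag_matrix (\<lambda>i. indicator J i * d i) ** transpose Q) \<le> r"
    "norm (A - Q ** diag_matrix (\<lambda>i. indicator J i * d i) ** transpose Q) \<le> nuclear_norm A - ky_fan_norm r A"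
proof -
  have "transpose A = A"
    using A by (simp add: sym_matrices_def)
  then obtain Q d where Q: "orthogonal_matrix Q" and eq: "A = Q ** diag_matrix d ** transpose Q"
    by (rule symmetric_matrix_diagonalization)
  define B where "B = diag_matrix d ** transpose Q"
  have B: "orthogonal_rows B"
    unfolding B_def by (rule orthogonal_rows_diag_transpose[OF Q])
  have eq': "A = Q ** B"
    unfolding eq B_def by (simp add: matrix_mul_assoc)
  obtain J where J: "rank (Q ** (diag_matrix (indicator J) ** B)) \<le> r"
      "norm (A - Q ** (diag_matrix (indicator J) ** B)) \<le> nuclear_norm A - ky_fan_norm r A"
    by (rule row_truncation[OF r Q B, folded eq'])
  have dd: "diag_matrix (indicator J) ** diag_matrix d = diag_matrix (\<lambda>i. indicator J i * d i)"
    by (simp add: vec_eq_iff diag_matrix_mult)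
  have "Q ** (diag_matrix (indicator J) ** B)
      = Q ** diag_matrix (\<lambda>i. indicator J i * d i) ** transpose Q"
    unfolding B_def dd[symmetric] by (simp only: matrix_mul_assoc)
  with J show ?thesis
    using that[OF Q eq] by simp
qed

lemma infdist_low_rank_sym_le:
  fixes A :: "real^'n^'n"
  assumes r: "r \<le> CARD('n)" and A: "A \<in> sym_matrices"
  shows "infdist A (low_rank sym_matrices r) \<le> nuclear_norm A - ky_fan_norm r A"
proof (rule symmetric_row_truncation[OF r A])
  fix Q :: "real^'n^'n" and d and J :: "'n set"
  let ?Y = "Q ** diag_matrix (\<lambda>i. indicator J i * d i) ** transpose Q"
  assume "rank ?Y \<le> r" "norm (A - ?Y) \<le> nuclear_norm A - ky_fan_norm r A"
  then show ?thesis
    by (intro infdist_le2[of ?Y]) (simp_all add: low_rank_def sym_matrices_def transpose_orthogonal_conj_diag dist_norm)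
qed

lemma infdist_low_rank_psd_le:
  fixes A :: "real^'n^'n"
  assumes r: "r \<le> CARD('n)" and A: "A \<in> psd_matrices"
  shows "infdist A (low_rank psd_matrices r) \<le> nuclear_norm A - ky_fan_norm r A"
proof (rule symmetric_row_truncation[OF r])
  show "A \<in> sym_matrices"
    using A by (simp add: psd_matrices_def)
  fix Q :: "real^'n^'n" and d and J :: "'n set"
  let ?Y = "Q ** diag_matrix (\<lambda>i. indicator J i * d i) ** transpose Q"
  assume Q: "orthogonal_matrix Q" and eq: "A = Q ** diag_matrix d ** transpose Q"
    and Y: "rank ?Y \<le> r" "norm (A - ?Y) \<le> nuclear_norm A - ky_fan_norm r A"
  have "d i \<ge> 0" for i
  proof -
    let ?x = "Q *v axis i 1"
    have "transpose Q *v ?x = axis i 1"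
      using Q by (simp add: matrix_vector_mul_assoc orthogonal_matrix)
    then have "?x \<bullet> (A *v ?x) = (\<Sum>k\<in>UNIV. d k * (axis i 1 $ k)\<^sup>2)"
      unfolding eq quadratic_form_conj_diag by (simp only:)
    also have "\<dots> = (\<Sum>k\<in>UNIV. if k = i then d k else 0)"
      by (intro sum.cong) (simp_all add: axis_def)
    finally have "?x \<bullet> (A *v ?x) = d i"
      by simp
    moreover have "0 \<le> ?x \<bullet> (A *v ?x)"
      using A by (simp add: psd_matrices_def)
    ultimately show ?thesis by simp
  qed
  then have "?Y \<in> psd_matrices"
    unfolding psd_matrices_def sym_matrices_def
    by (simp add: transpose_orthogonal_conj_diag quadratic_form_conj_diag sum_nonneg)
  then show ?thesis
    using Y by (intro infdist_le2[of ?Y]) (simp_all add: low_rank_def dist_norm)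
qed

section \<open>Error bounds from normal cones\<close>

text \<open>
  Fermat's rule for a differentiable function on an arbitrary set.
\<close>
lemma frechet_normal_of_constrained_minimum:
  fixes g :: "'a::euclidean_space"
  assumes h: "(h has_derivative (\<lambda>y. g \<bullet> y)) (at x0)"
    and min: "\<And>x. x \<in> S \<Longrightarrow> h x0 \<le> h x"
    and E: "- g \<in> E"
  shows "- g \<in> frechet_normal_cone E S x0"
proof -
  have lim: "((\<lambda>y. norm (h y - h x0 - g \<bullet> (y - x0)) / norm (y - x0)) \<longlongrightarrow> 0) (at x0 within S)"
    using has_derivative_at_withinI[OF h, of S] by (simp add: has_derivative_iff_norm)
  have "Limsup (at x0 within S) (\<lambda>x. ereal ((- g \<bullet> (x - x0)) / norm (x - x0))) \<le> 0"
    unfolding Limsup_le_iff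
  proof (intro allI impI)
    fix t :: ereal assume "0 < t"
    then obtain s :: real where s: "0 < s" "ereal s < t"
      using ereal_dense2 by (metis ereal_less(2))
    have "eventually (\<lambda>y. norm (h y - h x0 - g \<bullet> (y - x0)) / norm (y - x0) < s) (at x0 within S)"
      using order_tendstoD(2)[OF lim s(1)] .
    moreover have "eventually (\<lambda>y. y \<in> S) (at x0 within S)"
      by (simp add: eventually_at_filter)
    ultimately show "eventually (\<lambda>x. ereal ((- g \<bullet> (x - x0)) / norm (x - x0)) < t) (at x0 within S)"
    proof eventually_elim
      case (elim y)
      have "- g \<bullet> (y - x0) \<le> norm (h y - h x0 - g \<bullet> (y - x0))"
        using min[OF elim(2)] by simp
      then have "(- g \<bullet> (y - x0)) / norm (y - x0) \<le> norm (h y - h x0 - g \<bullet> (y - x0)) / norm (y - x0)"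
        by (intro divide_right_mono) auto
      also have "\<dots> < s" by (rule elim(1))
      finally have "ereal ((- g \<bullet> (y - x0)) / norm (y - x0)) < ereal s" by simp
      then show ?case using s(2) by (rule less_trans)
    qed
  qed
  then show ?thesis
    using E by (simp add: frechet_normal_cone_def)
qed

text \<open>
  The objective is smooth at \<open>x0\<close> because \<open>x0 \<noteq> w\<close>.  The quadratic term, with its small gradient, is
  used instead of a distance term so that exact Frechet normals result.
\<close>
lemma frechet_normal_of_distance_minimum:
  fixes E :: "'a::euclidean_space set"
  assumes E: "subspace E" and mem: "x0 \<in> E" "w \<in> E" "z \<in> E"
    and ne: "x0 \<noteq> w"
    and min: "\<And>x. x \<in> S \<Longrightarrow> norm (x0 - w) + c * (norm (x0 - z))\<^sup>2 \<le> norm (x - w) + c * (norm (x - z))\<^sup>2"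
  shows "- sgn (x0 - w) - (2 * c) *\<^sub>R (x0 - z) \<in> frechet_normal_cone E S x0"
proof -
  let ?g = "sgn (x0 - w) + (2 * c) *\<^sub>R (x0 - z)"
  have "((\<lambda>x. norm (x - w)) has_derivative (\<lambda>y. y \<bullet> sgn (x0 - w))) (at x0)"
  proof (rule has_derivative_compose[of "\<lambda>x. x - w" "\<lambda>y. y"])
    show "((\<lambda>x. x - w) has_derivative (\<lambda>y. y)) (at x0)"
      by (auto intro!: derivative_eq_intros)
    show "(norm has_derivative (\<lambda>y. y \<bullet> sgn (x0 - w))) (at (x0 - w))"
      using ne by (intro has_derivative_norm) simp
  qed
  moreover have "((\<lambda>x. c * (norm (x - z))\<^sup>2) has_derivative (\<lambda>y. (2 * c) * ((x0 - z) \<bullet> y))) (at x0)"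
    unfolding power2_norm_eq_inner
    by (rule derivative_eq_intros refl)+ (simp add: inner_commute algebra_simps)
  ultimately have "((\<lambda>x. norm (x - w) + c * (norm (x - z))\<^sup>2) has_derivative
      (\<lambda>y. y \<bullet> sgn (x0 - w) + (2 * c) * ((x0 - z) \<bullet> y))) (at x0)"
    by (rule has_derivative_add)
  moreover have "(\<lambda>y. y \<bullet> sgn (x0 - w) + (2 * c) * ((x0 - z) \<bullet> y)) = (\<lambda>y. ?g \<bullet> y)"
    by (simp add: inner_add_right inner_commute)
  ultimately have "((\<lambda>x. norm (x - w) + c * (norm (x - z))\<^sup>2) has_derivative (\<lambda>y. ?g \<bullet> y)) (at x0)"
    by simp
  moreover have "- ?g \<in> E"
    using E mem unfolding sgn_div_norm
    by (intro subspace_neg subspace_add subspace_scale subspace_diff) auto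
  ultimately have "- ?g \<in> frechet_normal_cone E S x0"
    using min by (intro frechet_normal_of_constrained_minimum)
  then show ?thesis by simp
qed

text \<open>
  A quantitative failure of the error bound at \<open>Z\<close> produces nearly opposite normals of length
  nearly 1.  With
  \<open>\<epsilon>\<close> the distance of \<open>Z\<close> to \<open>B\<close>, attained at \<open>Y\<close>, one minimises
  \<open>norm (x - y) + c * (norm (x - Z))\<^sup>2 + c * (norm (y - Y))\<^sup>2\<close> over \<open>A \<times> B\<close>.  The value at \<open>(Z, Y)\<close> is
  \<open>\<epsilon>\<close>, and \<open>c\<close> is chosen such that a displacement by \<open>\<kappa> * \<epsilon>\<close> already costs \<open>\<epsilon>\<close>; this
  keeps the minimiser within \<open>\<kappa> * \<epsilon>\<close> of \<open>(Z, Y)\<close> componentwise and the gradients of the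
  quadratic terms at most \<open>2 / \<kappa>\<close> in norm.  The minimiser does not satisfy \<open>x = y\<close>, since this would be a point of \<open>A \<inter> B\<close> too close
  to \<open>Z\<close>.
\<close>
lemma separated_point_opposite_normals:
  fixes A B E :: "'a::euclidean_space set"
  assumes E: "subspace E" "A \<subseteq> E" "B \<subseteq> E" and cl: "closed A" "closed B"
    and Z: "Z \<in> A" and B: "B \<noteq> {}" and \<kappa>: "\<kappa> > 0"
    and sep: "\<kappa> * infdist Z B < infdist Z (A \<inter> B)"
  obtains x y u a b where "x \<in> A" "y \<in> B" "norm u = 1"
    "norm (x - Z) \<le> \<kappa> * infdist Z B" "norm (x - y) \<le> infdist Z B"
    "norm a \<le> 2 / \<kappa>" "norm b \<le> 2 / \<kappa>"
    "- u - a \<in> frechet_normal_cone E A x" "u - b \<in> frechet_normal_cone E B y"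
proof -
  define \<epsilon> where "\<epsilon> = infdist Z B"
  obtain Y where Y: "Y \<in> B" and dY: "norm (Z - Y) = \<epsilon>"
    using infdist_attains_inf[OF cl(2) B, of Z] by (metis \<epsilon>_def dist_norm)
  have "\<epsilon> \<noteq> 0"
  proof
    assume "\<epsilon> = 0"
    then have "Z \<in> A \<inter> B" using dY Y Z by auto
    then show False using sep \<open>\<epsilon> = 0\<close> by (simp add: \<epsilon>_def)
  qed
  then have \<epsilon>: "\<epsilon> > 0"
    using infdist_nonneg[of Z B] by (simp add: \<epsilon>_def)
  define c where "c = 1 / (\<kappa>\<^sup>2 * \<epsilon>)"
  have c: "c > 0" using \<kappa> \<epsilon> by (simp add: c_def)
  have c\<kappa>: "c * (\<kappa> * \<epsilon>)\<^sup>2 = \<epsilon>"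
    using \<kappa> \<epsilon> by (simp add: c_def power2_eq_square)
  define \<psi> where "\<psi> p = norm (fst p - snd p) + c * (norm (fst p - Z))\<^sup>2 + c * (norm (snd p - Y))\<^sup>2" for p
  define K where "K = (A \<inter> cball Z (\<kappa> * \<epsilon>)) \<times> (B \<inter> cball Y (\<kappa> * \<epsilon>))"
  have "compact K"
    unfolding K_def by (intro compact_Times closed_Int_compact cl compact_cball)
  moreover have ZY: "(Z, Y) \<in> K"
    using Z Y \<kappa> \<epsilon> by (simp add: K_def)
  moreover have "continuous_on K \<psi>"
    unfolding \<psi>_def by (intro continuous_intros)
  ultimately obtain p where p: "p \<in> K" and p_min: "\<And>q. q \<in> K \<Longrightarrow> \<psi> p \<le> \<psi> q"
    using continuous_attains_inf[of K \<psi>] by blast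
  have \<psi>ZY: "\<psi> (Z, Y) = \<epsilon>"
    by (simp add: \<psi>_def dY)
  have far: "\<epsilon> \<le> c * d\<^sup>2" if "d \<ge> \<kappa> * \<epsilon>" for d
  proof -
    have "(\<kappa> * \<epsilon>)\<^sup>2 \<le> d\<^sup>2"
      using that \<kappa> \<epsilon> by (intro power_mono) auto
    then have "c * (\<kappa> * \<epsilon>)\<^sup>2 \<le> c * d\<^sup>2"
      using c by (intro mult_left_mono) auto
    then show ?thesis by (simp add: c\<kappa>)
  qed
  have min: "\<psi> p \<le> \<psi> q" if q: "q \<in> A \<times> B" for q
  proof (cases "q \<in> K")
    case False
    then consider "norm (fst q - Z) \<ge> \<kappa> * \<epsilon>" | "norm (snd q - Y) \<ge> \<kappa> * \<epsilon>"
      using q by (fastforce simp: K_def dist_norm norm_minus_commute)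
    then have "\<epsilon> \<le> c * (norm (fst q - Z))\<^sup>2 + c * (norm (snd q - Y))\<^sup>2"
    proof cases
      case 1
      show ?thesis using far[OF 1] c by (simp add: add_increasing2)
    next
      case 2
      show ?thesis using far[OF 2] c by (simp add: add_increasing)
    qed
    then have "\<epsilon> \<le> \<psi> q"
      unfolding \<psi>_def using norm_ge_zero[of "fst q - snd q"] by linarith
    then show ?thesis
      using p_min[OF ZY] \<psi>ZY by simp
  qed (rule p_min)
  define x y where "x = fst p" and "y = snd p"
  have xA: "x \<in> A" and yB: "y \<in> B" and xZ: "norm (x - Z) \<le> \<kappa> * \<epsilon>" and yY: "norm (y - Y) \<le> \<kappa> * \<epsilon>"
    using p by (auto simp: K_def x_def y_def dist_norm norm_minus_commute)
  have "\<psi> p \<le> \<epsilon>"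
    using p_min[OF ZY] \<psi>ZY by simp
  moreover have "norm (x - y) \<le> \<psi> p"
    using c by (simp add: \<psi>_def x_def y_def)
  ultimately have xy: "norm (x - y) \<le> \<epsilon>" by simp
  have ne: "x \<noteq> y"
  proof
    assume "x = y"
    then have "infdist Z (A \<inter> B) \<le> \<kappa> * \<epsilon>"
      using xA yB xZ by (intro infdist_le2[of x]) (auto simp: dist_norm norm_minus_commute)
    then show False using sep by (simp add: \<epsilon>_def)
  qed
  have small: "norm ((2 * c) *\<^sub>R v) \<le> 2 / \<kappa>" if "norm v \<le> \<kappa> * \<epsilon>" for v :: 'a
  proof -
    have "norm ((2 * c) *\<^sub>R v) \<le> (2 * c) * (\<kappa> * \<epsilon>)"
      using that c by simp
    also have "\<dots> = 2 / \<kappa>"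
      using \<kappa> \<epsilon> by (simp add: c_def power2_eq_square)
    finally show ?thesis .
  qed
  have memE: "x \<in> E" "y \<in> E" "Z \<in> E" "Y \<in> E"
    using E xA yB Z Y by auto
  have "- sgn (x - y) - (2 * c) *\<^sub>R (x - Z) \<in> frechet_normal_cone E A x"
  proof (rule frechet_normal_of_distance_minimum[OF E(1) memE(1,2,3) ne])
    fix v assume "v \<in> A"
    then show "norm (x - y) + c * (norm (x - Z))\<^sup>2 \<le> norm (v - y) + c * (norm (v - Z))\<^sup>2"
      using min[of "(v, y)"] yB by (simp add: \<psi>_def x_def y_def)
  qed
  moreover have "- sgn (y - x) - (2 * c) *\<^sub>R (y - Y) \<in> frechet_normal_cone E B y"
  proof (rule frechet_normal_of_distance_minimum[OF E(1) memE(2,1,4) ne[symmetric]])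
    fix v assume "v \<in> B"
    then show "norm (y - x) + c * (norm (y - Y))\<^sup>2 \<le> norm (v - x) + c * (norm (v - Y))\<^sup>2"
      using min[of "(x, v)"] xA by (simp add: \<psi>_def x_def y_def norm_minus_commute)
  qed
  moreover have "- sgn (y - x) = sgn (x - y)"
    by (metis minus_diff_eq sgn_minus)
  ultimately show ?thesis
    using that[of x y "sgn (x - y)" "(2 * c) *\<^sub>R (x - Z)" "(2 * c) *\<^sub>R (y - Y)"]
      xA yB xZ xy ne small[OF xZ] small[OF yY] by (simp add: norm_sgn \<epsilon>_def)
qed

text \<open>
  If no constant works, \<open>separated_point_opposite_normals\<close> applies with \<open>\<kappa> = 1, 2, 3, \<dots>\<close> at points \<open>Z\<close> tending to \<open>X\<close>.
  By compactness of the unit sphere the unit vectors have a limit point \<open>v\<close>, and \<open>- v\<close> and \<open>v\<close> are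
  limiting normals to \<open>A\<close> and \<open>B\<close> at \<open>X\<close>.
\<close>
theorem normal_qualification_error_bound:
  fixes A B E :: "'a::euclidean_space set"
  assumes E: "subspace E" "A \<subseteq> E" "B \<subseteq> E" and cl: "closed A" "closed B"
    and X: "X \<in> A" "X \<in> B"
    and qual: "uminus ` limiting_normal_cone E A X \<inter> limiting_normal_cone E B X \<subseteq> {0}"
  shows "\<exists>c>0. \<exists>\<delta>>0. \<forall>Z\<in>A \<inter> cball X \<delta>. infdist Z (A \<inter> B) \<le> c * infdist Z B"
proof (rule ccontr)
  assume neg: "\<not> ?thesis"
  define \<kappa> where "\<kappa> k = real (Suc k)" for k
  have \<kappa>: "\<kappa> k > 0" "\<kappa> k \<ge> 1" for k by (auto simp: \<kappa>_def)
  have "\<exists>Z x y u a b. Z \<in> cball X (1 / \<kappa> k) \<and> x \<in> A \<and> y \<in> B \<and> norm u = 1 \<and>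
      norm (x - Z) \<le> 1 / \<kappa> k \<and> norm (x - y) \<le> 1 / \<kappa> k \<and>
      norm a \<le> 2 / \<kappa> k \<and> norm b \<le> 2 / \<kappa> k \<and>
      - u - a \<in> frechet_normal_cone E A x \<and> u - b \<in> frechet_normal_cone E B y" for k
  proof -
    have "1 / \<kappa> k > 0" using \<kappa>(1)[of k] by simp
    then obtain Z where Z: "Z \<in> A" "Z \<in> cball X (1 / \<kappa> k)" and sep: "\<kappa> k * infdist Z B < infdist Z (A \<inter> B)"
      using neg \<kappa>(1)[of k] by (meson IntE not_le)
    have "infdist Z (A \<inter> B) \<le> 1 / \<kappa> k"
      using X Z by (intro infdist_le2[of X]) (auto simp: dist_commute)
    then have le: "\<kappa> k * infdist Z B \<le> 1 / \<kappa> k"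
      using sep by simp
    have "infdist Z B \<le> \<kappa> k * infdist Z B"
      using \<kappa>(2)[of k] infdist_nonneg[of Z B] mult_right_mono[of 1 "\<kappa> k" "infdist Z B"] by simp
    then have le': "infdist Z B \<le> 1 / \<kappa> k" using le by simp
    have Bne: "B \<noteq> {}" using X by auto
    show ?thesis
      by (rule separated_point_opposite_normals[OF E cl Z(1) Bne \<kappa>(1) sep])
         (use Z(2) le le' in \<open>blast intro: order_trans\<close>)
  qed
  then obtain Z x y u a b where seq: "\<And>k. Z k \<in> cball X (1 / \<kappa> k)" "\<And>k. x k \<in> A" "\<And>k. y k \<in> B"
      "\<And>k. norm (u k) = 1"
      "\<And>k. norm (x k - Z k) \<le> 1 / \<kappa> k" "\<And>k. norm (x k - y k) \<le> 1 / \<kappa> k"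
      "\<And>k. norm (a k) \<le> 2 / \<kappa> k" "\<And>k. norm (b k) \<le> 2 / \<kappa> k"
    and normal: "\<And>k. - u k - a k \<in> frechet_normal_cone E A (x k)" "\<And>k. u k - b k \<in> frechet_normal_cone E B (y k)"
    by metis
  have to0: "(\<lambda>k. C / \<kappa> k) \<longlonglongrightarrow> 0" for C
    unfolding \<kappa>_def using LIMSEQ_Suc[OF lim_const_over_n[of C]] by simp
  have null: "f \<longlonglongrightarrow> 0" if "\<And>k. norm (f k) \<le> C / \<kappa> k" for f :: "nat \<Rightarrow> 'a" and C
    using that by (intro Lim_null_comparison[OF always_eventually to0]) blast
  have a0: "a \<longlonglongrightarrow> 0" and b0: "b \<longlonglongrightarrow> 0"
    by (rule null[OF seq(7)], rule null[OF seq(8)])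
  have "(\<lambda>k. Z k - X) \<longlonglongrightarrow> 0"
    by (rule null[of _ 1]) (use seq(1) in \<open>simp add: dist_norm norm_minus_commute\<close>)
  moreover have "(\<lambda>k. x k - Z k) \<longlonglongrightarrow> 0" "(\<lambda>k. x k - y k) \<longlonglongrightarrow> 0"
    by (rule null[OF seq(5)], rule null[OF seq(6)])
  ultimately have "(\<lambda>k. (x k - Z k) + (Z k - X) + X) \<longlonglongrightarrow> 0 + 0 + X"
    by (intro tendsto_intros)
  then have x: "x \<longlonglongrightarrow> X" by simp
  from \<open>(\<lambda>k. x k - y k) \<longlonglongrightarrow> 0\<close> have "(\<lambda>k. x k - (x k - y k)) \<longlonglongrightarrow> X - 0"
    by (intro tendsto_diff x)
  then have y: "y \<longlonglongrightarrow> X" by simp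
  have "\<forall>k. u k \<in> sphere 0 1" using seq(4) by simp
  then obtain v r where v: "v \<in> sphere 0 1" and r: "strict_mono r" and ur: "(u \<circ> r) \<longlonglongrightarrow> v"
    using compact_sphere[of "0 :: 'a" 1] unfolding compact_def by metis
  note sub = LIMSEQ_subseq_LIMSEQ[OF _ r]
  have lim_u: "(\<lambda>k. - (u \<circ> r) k - (a \<circ> r) k) \<longlonglongrightarrow> - v - 0" "(\<lambda>k. (u \<circ> r) k - (b \<circ> r) k) \<longlonglongrightarrow> v - 0"
    by (intro tendsto_intros ur sub[OF a0] sub[OF b0])+
  have in_E: "w \<in> E" if "\<And>k. f k \<in> E" "f \<longlonglongrightarrow> w" for f :: "nat \<Rightarrow> 'a" and w
    using closed_sequentially[OF closed_subspace[OF E(1)]] that by blast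
  have "- v \<in> limiting_normal_cone E A X"
    unfolding limiting_normal_cone_def
  proof (intro CollectI conjI exI)
    show "\<forall>k. (x \<circ> r) k \<in> A \<and> (- (u \<circ> r) k - (a \<circ> r) k) \<in> frechet_normal_cone E A ((x \<circ> r) k)"
      using seq(2) normal(1) by simp
    show "(x \<circ> r) \<longlonglongrightarrow> X" by (rule sub[OF x])
    show "(\<lambda>k. - (u \<circ> r) k - (a \<circ> r) k) \<longlonglongrightarrow> - v" using lim_u(1) by simp
    show "- v \<in> E"
      by (rule in_E[OF _ \<open>(\<lambda>k. - (u \<circ> r) k - (a \<circ> r) k) \<longlonglongrightarrow> - v\<close>])
         (use normal(1) in \<open>auto simp: frechet_normal_cone_def\<close>)
  qed
  moreover have "v \<in> limiting_normal_cone E B X"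
    unfolding limiting_normal_cone_def
  proof (intro CollectI conjI exI)
    show "\<forall>k. (y \<circ> r) k \<in> B \<and> ((u \<circ> r) k - (b \<circ> r) k) \<in> frechet_normal_cone E B ((y \<circ> r) k)"
      using seq(3) normal(2) by simp
    show "(y \<circ> r) \<longlonglongrightarrow> X" by (rule sub[OF y])
    show "(\<lambda>k. (u \<circ> r) k - (b \<circ> r) k) \<longlonglongrightarrow> v" using lim_u(2) by simp
    show "v \<in> E"
      by (rule in_E[OF _ \<open>(\<lambda>k. (u \<circ> r) k - (b \<circ> r) k) \<longlonglongrightarrow> v\<close>])
         (use normal(2) in \<open>auto simp: frechet_normal_cone_def\<close>)
  qed
  ultimately have "v \<in> {0}"
    using qual by force
  then show False using v by simp
qed

section \<open>Calmness and exact penalisation\<close>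

lemma mem_scaled_cball_iff:
  fixes M :: "'z::euclidean_space set"
  assumes "0 \<le> t"
  shows "x \<in> {z + t *\<^sub>R b | z b. z \<in> M \<and> b \<in> cball 0 1} \<longleftrightarrow> (\<exists>z\<in>M. dist x z \<le> t)"
proof
  assume "x \<in> {z + t *\<^sub>R b | z b. z \<in> M \<and> b \<in> cball 0 1}"
  then obtain z b where "x = z + t *\<^sub>R b" "z \<in> M" "norm b \<le> 1" by auto
  then show "\<exists>z\<in>M. dist x z \<le> t"
    using assms by (intro bexI[of _ z]) (simp_all add: dist_norm mult_left_le)
next
  assume "\<exists>z\<in>M. dist x z \<le> t"
  then obtain z where z: "z \<in> M" "norm (x - z) \<le> t" by (auto simp: dist_norm)
  \<comment> \<open>For \<open>t = 0\<close> one has \<open>x = z\<close>, and \<open>?b\<close> is 0.\<close>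
  let ?b = "(1 / t) *\<^sub>R (x - z)"
  have "x = z + t *\<^sub>R ?b"
    using z(2) by (cases "t = 0") auto
  moreover have "?b \<in> cball 0 1"
    using z(2) assms by (cases "t = 0") (auto simp: divide_le_eq)
  ultimately show "x \<in> {z + t *\<^sub>R b | z b. z \<in> M \<and> b \<in> cball 0 1}"
    using z(1) by blast
qed

text \<open>
  Calmness of a level-set multifunction at 0 is a local bound of the distance to the zero level by
  a multiple of the level, among points with a small level.  It passes from \<open>p\<close> to any \<open>q\<close> that dominates
  \<open>p\<close> up to a factor and has the same zeros.
\<close>
lemma calm_level_sets_mono:
  fixes p q :: "'z::euclidean_space \<Rightarrow> real"
  assumes calm: "calm_at (\<lambda>\<tau>. {x \<in> \<Omega>. p x = \<tau>}) 0 z0"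
    and C: "C > 0" and le: "\<And>x. x \<in> \<Omega> \<Longrightarrow> \<bar>p x\<bar> \<le> C * \<bar>q x\<bar>"
    and zero: "\<And>x. x \<in> \<Omega> \<Longrightarrow> p x = 0 \<Longrightarrow> q x = 0"
  shows "calm_at (\<lambda>\<tau>. {x \<in> \<Omega>. q x = \<tau>}) 0 z0"
proof -
  obtain \<gamma> \<epsilon> \<delta> where pos: "\<gamma> \<ge> 0" "\<epsilon> > 0" "\<delta> > 0"
    and p: "\<forall>\<tau>. norm (\<tau> - 0) \<le> \<epsilon> \<longrightarrow> {x \<in> \<Omega>. p x = \<tau>} \<inter> cball z0 \<delta> \<subseteq>
        {z + (\<gamma> * norm (\<tau> - 0)) *\<^sub>R b | z b. z \<in> {x \<in> \<Omega>. p x = 0} \<and> b \<in> cball 0 1}"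
    and z0: "z0 \<in> {x \<in> \<Omega>. p x = 0}"
    using calm unfolding calm_at_def by (elim conjE exE) (rule that)
  have "x \<in> {z + (\<gamma> * C * norm (\<tau> - 0)) *\<^sub>R b | z b. z \<in> {x \<in> \<Omega>. q x = 0} \<and> b \<in> cball 0 1}"
    if \<tau>: "norm (\<tau> - 0) \<le> \<epsilon> / C" and x: "x \<in> {x \<in> \<Omega>. q x = \<tau>} \<inter> cball z0 \<delta>" for \<tau> x
  proof -
    have px: "\<bar>p x\<bar> \<le> C * \<bar>\<tau>\<bar>"
      using le[of x] x by simp
    also have "\<dots> \<le> \<epsilon>"
      using \<tau> C by (simp add: pos_le_divide_eq mult.commute)
    finally have "norm (p x - 0) \<le> \<epsilon>" by simp
    then have "{y \<in> \<Omega>. p y = p x} \<inter> cball z0 \<delta> \<subseteq>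
        {z + (\<gamma> * norm (p x - 0)) *\<^sub>R b | z b. z \<in> {x \<in> \<Omega>. p x = 0} \<and> b \<in> cball 0 1}"
      using p by blast
    with x have "x \<in> {z + (\<gamma> * norm (p x - 0)) *\<^sub>R b | z b. z \<in> {x \<in> \<Omega>. p x = 0} \<and> b \<in> cball 0 1}"
      by blast
    then obtain z where z: "z \<in> {x \<in> \<Omega>. p x = 0}" "dist x z \<le> \<gamma> * \<bar>p x\<bar>"
      using pos(1) by (subst (asm) mem_scaled_cball_iff) auto
    have "\<gamma> * \<bar>p x\<bar> \<le> \<gamma> * (C * \<bar>\<tau>\<bar>)"
      using px pos(1) by (rule mult_left_mono)
    then have "dist x z \<le> \<gamma> * C * norm (\<tau> - 0)"
      using z(2) by (simp add: mult.assoc)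
    moreover have "z \<in> {x \<in> \<Omega>. q x = 0}"
      using z(1) zero by auto
    ultimately show ?thesis
      using pos(1) C by (subst mem_scaled_cball_iff) auto
  qed
  moreover have "z0 \<in> {x \<in> \<Omega>. q x = 0}"
    using z0 zero by auto
  moreover have "\<gamma> * C \<ge> 0" "\<epsilon> / C > 0"
    using pos C by auto
  ultimately show ?thesis
    unfolding calm_at_def
    by (intro conjI exI[of _ "\<gamma> * C"] exI[of _ "\<epsilon> / C"] exI[of _ \<delta>] allI impI subsetI pos(3))
qed

lemma coercive_onD:
  assumes "coercive_on S f"
  shows "\<exists>R. \<forall>x\<in>S. R \<le> norm x \<longrightarrow> ereal c < f x"
proof -
  have "eventually (\<lambda>x. ereal c < f x) (inf at_infinity (principal S))"
    using assms order_tendstoD(1) unfolding coercive_on_def by fastforce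
  then show ?thesis
    by (auto simp: eventually_inf_principal eventually_at_infinity)
qed

text \<open>
  Let \<open>y\<close> be a feasible point nearest to \<open>z\<close>.  Moving from \<open>z\<close> to \<open>y\<close> changes \<open>g\<close> by at most
  \<open>L * dist z y \<le> L * c * p z\<close>.  The radius is at most
  half that of a ball on which \<open>g\<close> is Lipschitz, because \<open>y\<close> may be as far from \<open>z\<close> as \<open>x\<close> is.
\<close>
lemma local_penalty_bound_at_feasible:
  fixes g p :: "'a::euclidean_space \<Rightarrow> real"
  assumes \<Gamma>: "closed \<Gamma>" "\<Gamma> \<subseteq> \<Omega>" and x: "x \<in> \<Gamma>"
    and N: "open N" "x \<in> N" "L-lipschitz_on (N \<inter> \<Omega>) g"
    and err: "\<delta> > 0" "\<forall>z\<in>\<Omega> \<inter> cball x \<delta>. infdist z \<Gamma> \<le> c * p z"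
    and low: "\<And>y. y \<in> \<Gamma> \<Longrightarrow> m \<le> g y"
  shows "\<exists>\<rho> \<eta>. \<eta> > 0 \<and> (\<forall>z\<in>\<Omega> \<inter> cball x \<eta>. m \<le> g z + \<rho> * p z)"
proof -
  obtain e where e: "e > 0" "cball x e \<subseteq> N"
    using N(1,2) open_contains_cball by blast
  define \<eta> where "\<eta> = min \<delta> (e / 2)"
  have "m \<le> g z + (L * c) * p z" if z: "z \<in> \<Omega>" "dist x z \<le> \<eta>" for z
  proof -
    obtain y where y: "y \<in> \<Gamma>" "infdist z \<Gamma> = dist z y"
      using infdist_attains_inf[OF \<Gamma>(1)] x by blast
    have "dist z y \<le> dist x z"
      using infdist_le[OF x, of z] y(2) by (simp add: dist_commute)
    then have "dist x y \<le> e"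
      using dist_triangle[of x y z] z(2) by (simp add: \<eta>_def)
    then have "y \<in> N \<inter> \<Omega>" "z \<in> N \<inter> \<Omega>"
      using e y(1) \<Gamma>(2) z by (auto simp: \<eta>_def)
    then have "dist (g z) (g y) \<le> L * dist z y"
      using N(3) by (intro lipschitz_onD)
    also have "\<dots> \<le> L * (c * p z)"
    proof (rule mult_left_mono)
      have "z \<in> \<Omega> \<inter> cball x \<delta>"
        using z by (simp add: \<eta>_def)
      then show "dist z y \<le> c * p z"
        using err(2) y(2) by metis
    qed (rule lipschitz_on_nonneg[OF N(3)])
    finally have "g y \<le> g z + (L * c) * p z"
      by (simp add: dist_real_def mult.assoc abs_le_iff)
    then show ?thesis
      using low[OF y(1)] by simp
  qed
  moreover have "\<eta> > 0"
    using err(1) e(1) by (simp add: \<eta>_def)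
  ultimately show ?thesis
    by (intro exI[of _ "L * c"] exI[of _ \<eta>]) auto
qed

text \<open>
  Raising the penalty parameter preserves a lower bound, as \<open>p\<close> is nonnegative.  A parameter that
  dominates those of a finite subcover therefore works on the compact part of \<open>\<Omega>\<close>.
\<close>
lemma uniform_penalty_bound:
  fixes g p :: "'a::euclidean_space \<Rightarrow> real"
  assumes \<Omega>: "closed \<Omega>"
    and R: "\<And>z. z \<in> \<Omega> \<Longrightarrow> R \<le> norm z \<Longrightarrow> m \<le> g z"
    and p: "\<And>z. z \<in> \<Omega> \<Longrightarrow> 0 \<le> p z"
    and loc: "\<And>x. x \<in> \<Omega> \<Longrightarrow> \<exists>\<rho> \<eta>. \<eta> > 0 \<and> (\<forall>z\<in>\<Omega> \<inter> cball x \<eta>. m \<le> g z + \<rho> * p z)"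
  shows "\<exists>\<rho>\<ge>0. \<forall>z\<in>\<Omega>. m \<le> g z + \<rho> * p z"
proof -
  obtain \<rho> \<eta> where \<rho>\<eta>: "\<And>x. x \<in> \<Omega> \<Longrightarrow> \<eta> x > 0 \<and> (\<forall>z\<in>\<Omega> \<inter> cball x (\<eta> x). m \<le> g z + \<rho> x * p z)"
    using loc by metis
  have \<rho>: "m \<le> g z + \<rho> x * p z" if "x \<in> \<Omega>" "z \<in> \<Omega>" "dist x z \<le> \<eta> x" for x z
    using \<rho>\<eta>[OF that(1)] that(2,3) by simp
  have comp: "compact (\<Omega> \<inter> cball 0 R)"
    by (intro closed_Int_compact \<Omega> compact_cball)
  have cover: "\<Omega> \<inter> cball 0 R \<subseteq> (\<Union>x\<in>\<Omega> \<inter> cball 0 R. ball x (\<eta> x))"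
    using \<rho>\<eta> by force
  obtain F where F: "F \<subseteq> \<Omega> \<inter> cball 0 R" "finite F" "\<Omega> \<inter> cball 0 R \<subseteq> (\<Union>x\<in>F. ball x (\<eta> x))"
    by (rule compactE_image[OF comp _ cover]) auto
  define \<rho>0 where "\<rho>0 = (\<Sum>x\<in>F. \<bar>\<rho> x\<bar>)"
  have "m \<le> g z + \<rho>0 * p z" if z: "z \<in> \<Omega>" for z
  proof (cases "R \<le> norm z")
    case True
    then show ?thesis
      using R[OF z] p[OF z] by (simp add: \<rho>0_def sum_nonneg add_increasing2)
  next
    case False
    then obtain x where x: "x \<in> F" "dist x z < \<eta> x"
      using F(3) z by (fastforce simp: subset_iff)
    then have "m \<le> g z + \<rho> x * p z"
      using \<rho>[of x z] F(1) z by auto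
    also have "\<rho> x \<le> \<rho>0"
      using member_le_sum[of x F "\<lambda>x. \<bar>\<rho> x\<bar>"] x(1) F(2) by (simp add: \<rho>0_def)
    then have "g z + \<rho> x * p z \<le> g z + \<rho>0 * p z"
      using p[OF z] by (simp add: mult_right_mono)
    finally show ?thesis .
  qed
  then show ?thesis
    by (intro exI[of _ \<rho>0]) (auto simp: \<rho>0_def sum_nonneg)
qed

text \<open>
  Let \<open>m\<close> be the infimum over \<open>\<Gamma>\<close>.  Once \<open>\<rho>1\<close> is so large that the penalised objective is at least \<open>m\<close> on
  \<open>\<Omega>\<close>, the parameter \<open>\<rho>1 + 1\<close> makes it exceed \<open>m\<close> strictly outside \<open>\<Gamma>\<close>, so no infeasible point is a
  minimiser.
\<close>
theorem exact_penalization: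
  fixes f :: "'a::euclidean_space \<Rightarrow> ereal" and p :: "'a \<Rightarrow> real"
  assumes \<Omega>: "closed \<Omega>" and \<Gamma>: "closed \<Gamma>" "\<Gamma> \<subseteq> \<Omega>" "\<Gamma> \<noteq> {}"
    and f: "bounded_below_on \<Omega> f" "coercive_on \<Omega> f" "locally_lipschitz_on \<Omega> f"
    and p: "\<And>z. z \<in> \<Omega> \<Longrightarrow> 0 \<le> p z" "\<And>z. z \<in> \<Gamma> \<Longrightarrow> p z = 0"
    and err: "\<And>x. x \<in> \<Gamma> \<Longrightarrow> \<exists>c. \<exists>\<delta>>0. \<forall>z\<in>\<Omega> \<inter> cball x \<delta>. infdist z \<Gamma> \<le> c * p z"
    and sep: "\<And>x. x \<in> \<Omega> - \<Gamma> \<Longrightarrow> \<exists>c>0. \<exists>\<delta>>0. \<forall>z\<in>\<Omega> \<inter> cball x \<delta>. c \<le> p z"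
  shows "\<exists>\<rho>0>0. \<forall>\<rho>\<ge>\<rho>0. global_minimizers \<Omega> (\<lambda>x. f x + ereal (\<rho> * p x)) = global_minimizers \<Gamma> f"
proof -
  define g where "g x = real_of_ereal (f x)" for x
  have fg: "f x = ereal (g x)" if "x \<in> \<Omega>" for x
    using f(3) that by (auto simp: g_def locally_lipschitz_on_def ereal_real)
  obtain l where "\<forall>x\<in>\<Omega>. ereal l \<le> f x"
    using f(1) unfolding bounded_below_on_def by blast
  then have l: "l \<le> g x" if "x \<in> \<Omega>" for x
    using fg[OF that] that by force
  define m where "m = (INF x\<in>\<Gamma>. g x)"
  have bdd: "bdd_below (g ` \<Gamma>)"
    using l \<Gamma>(2) by (intro bdd_belowI2[of _ l]) auto
  have m_le: "m \<le> g y" if "y \<in> \<Gamma>" for y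
    unfolding m_def using bdd that by (rule cINF_lower)
  have m_approx: "\<exists>y\<in>\<Gamma>. g y < t" if "m < t" for t
    using that cINF_less_iff[OF \<Gamma>(3) bdd] by (simp add: m_def)
  obtain R where R: "\<forall>x\<in>\<Omega>. R \<le> norm x \<longrightarrow> ereal m < f x"
    using coercive_onD[OF f(2)] by blast
  have loc: "\<exists>\<rho> \<eta>. \<eta> > 0 \<and> (\<forall>z\<in>\<Omega> \<inter> cball x \<eta>. m \<le> g z + \<rho> * p z)" if x: "x \<in> \<Omega>" for x
  proof (cases "x \<in> \<Gamma>")
    case True
    obtain N L where N: "open N" "x \<in> N" "L-lipschitz_on (N \<inter> \<Omega>) g"
      using f(3) x unfolding locally_lipschitz_on_def g_def by blast
    obtain c \<delta> where "\<delta> > 0" "\<forall>z\<in>\<Omega> \<inter> cball x \<delta>. infdist z \<Gamma> \<le> c * p z"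
      using err[OF True] by blast
    from local_penalty_bound_at_feasible[OF \<Gamma>(1,2) True N this m_le] show ?thesis .
  next
    case False
    then obtain c \<delta> where c: "c > 0" "\<delta> > 0" "\<forall>z\<in>\<Omega> \<inter> cball x \<delta>. c \<le> p z"
      using sep x by blast
    have "m \<le> g z + \<bar>m - l\<bar> / c * p z" if "z \<in> \<Omega> \<inter> cball x \<delta>" for z
    proof -
      have "\<bar>m - l\<bar> / c * c \<le> \<bar>m - l\<bar> / c * p z"
        using c that by (intro mult_left_mono) auto
      then have "\<bar>m - l\<bar> \<le> \<bar>m - l\<bar> / c * p z"
        using c(1) by simp
      moreover have "l \<le> g z" using l that by simp
      ultimately show ?thesis by linarith
    qed
    then show ?thesis using c(2) by blast
  qed
  have "\<exists>\<rho>\<ge>0. \<forall>z\<in>\<Omega>. m \<le> g z + \<rho> * p z"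
  proof (rule uniform_penalty_bound[OF \<Omega> _ p(1) loc])
    show "m \<le> g z" if "z \<in> \<Omega>" "R \<le> norm z" for z
      using R that fg[OF that(1)] by force
  qed
  then obtain \<rho>1 where \<rho>1: "\<rho>1 \<ge> 0" "\<And>z. z \<in> \<Omega> \<Longrightarrow> m \<le> g z + \<rho>1 * p z"
    by blast
  have pos: "p x > 0" if x: "x \<in> \<Omega>" "x \<notin> \<Gamma>" for x
  proof -
    obtain c \<delta> where c: "c > 0" "\<delta> > 0" "\<forall>z\<in>\<Omega> \<inter> cball x \<delta>. c \<le> p z"
      using sep[of x] x by blast
    then have "c \<le> p x" using x(1) by simp
    then show ?thesis using c(1) by simp
  qed
  have "global_minimizers \<Omega> (\<lambda>x. f x + ereal (\<rho> * p x)) = global_minimizers \<Gamma> f"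
    if \<rho>: "\<rho> \<ge> \<rho>1 + 1" for \<rho>
  proof -
    have pen: "f x + ereal (\<rho> * p x) = ereal (g x + \<rho> * p x)" if "x \<in> \<Omega>" for x
      using fg[OF that] by simp
    have gp: "g x + \<rho> * p x \<ge> m + p x" if x: "x \<in> \<Omega>" for x
    proof -
      have "(\<rho>1 + 1) * p x \<le> \<rho> * p x"
        using \<rho> p(1)[OF x] by (rule mult_right_mono)
      then show ?thesis
        using \<rho>1(2)[OF x] by (simp add: algebra_simps)
    qed
    have minI: "x \<in> global_minimizers S h \<longleftrightarrow> x \<in> S \<and> (\<forall>y\<in>S. h x \<le> h y)" for x S and h :: "'a \<Rightarrow> ereal"
      by (auto simp: global_minimizers_def is_arg_min_def not_less)
    show ?thesis
    proof (intro equalityI subsetI)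
      fix x assume "x \<in> global_minimizers \<Omega> (\<lambda>x. f x + ereal (\<rho> * p x))"
      then have x: "x \<in> \<Omega>" and min: "\<And>y. y \<in> \<Omega> \<Longrightarrow> g x + \<rho> * p x \<le> g y + \<rho> * p y"
        by (auto simp: minI pen)
      have min\<Gamma>: "g x + \<rho> * p x \<le> g y" if "y \<in> \<Gamma>" for y
        using min[of y] that \<Gamma>(2) p(2)[OF that] by auto
      have "x \<in> \<Gamma>"
      proof (rule ccontr)
        assume "x \<notin> \<Gamma>"
        then have "m < g x + \<rho> * p x"
          using pos[OF x] gp[OF x] by simp
        then show False
          using m_approx[of "g x + \<rho> * p x"] min\<Gamma> by (auto simp: not_less[symmetric])
      qed
      then show "x \<in> global_minimizers \<Gamma> f"
        using min\<Gamma> fg \<Gamma>(2) p(2) by (auto simp: minI subset_iff)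
    next
      fix x assume "x \<in> global_minimizers \<Gamma> f"
      then have x: "x \<in> \<Gamma>" and min: "\<And>y. y \<in> \<Gamma> \<Longrightarrow> g x \<le> g y"
        using fg \<Gamma>(2) by (auto simp: minI subset_iff)
      have "g x \<le> m"
        unfolding m_def using \<Gamma>(3) min by (rule cINF_greatest)
      then have "g x + \<rho> * p x \<le> g y + \<rho> * p y" if "y \<in> \<Omega>" for y
        using gp[OF that] p(1)[OF that] p(2)[OF x] by simp
      then show "x \<in> global_minimizers \<Omega> (\<lambda>x. f x + ereal (\<rho> * p x))"
        using x \<Gamma>(2) by (auto simp: minI pen)
    qed
  qed
  then show ?thesis
    using \<rho>1(1) by (intro exI[of _ "\<rho>1 + 1"]) auto
qed

section \<open>Rank-constrained problems\<close>

lemma calm_S_map_iff_calm_M_map: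
  fixes \<Omega> :: "(real^'m^'n) set"
  assumes r: "r \<in> {1..CARD('n)}"
  shows "calm_at (S_map \<Omega> r) 0 X \<longleftrightarrow> calm_at (M_map \<Omega> r) 0 X"
proof -
  let ?K = "\<lambda>A :: real^'m^'n. nuclear_norm A - ky_fan_norm r A"
  let ?T = "\<lambda>A :: real^'m^'n. nuclear_norm A - H_fun r A"
  have bounds: "\<bar>?K A\<bar> \<le> 2 * \<bar>?T A\<bar>" "\<bar>?T A\<bar> \<le> 1 * \<bar>?K A\<bar>" for A :: "real^'m^'n"
    using nuclear_minus_ky_fan_nonneg[of r A] nuclear_minus_H_bounds[OF r, of A] r by auto
  have zero: "?K A = 0 \<longleftrightarrow> ?T A = 0" for A
    using bounds[of A] by (metis abs_le_zero_iff abs_zero mult_zero_right)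
  have maps: "S_map \<Omega> r = (\<lambda>\<tau>. {A \<in> \<Omega>. ?K A = \<tau>})" "M_map \<Omega> r = (\<lambda>\<tau>. {A \<in> \<Omega>. ?T A = \<tau>})"
    by (simp_all add: S_map_def M_map_def fun_eq_iff)
  show ?thesis
    unfolding maps
  proof
    assume S: "calm_at (\<lambda>\<tau>. {A \<in> \<Omega>. ?K A = \<tau>}) 0 X"
    show "calm_at (\<lambda>\<tau>. {A \<in> \<Omega>. ?T A = \<tau>}) 0 X"
      by (rule calm_level_sets_mono[OF S zero_less_numeral bounds(1)]) (rule iffD1[OF zero])
  next
    assume M: "calm_at (\<lambda>\<tau>. {A \<in> \<Omega>. ?T A = \<tau>}) 0 X"
    show "calm_at (\<lambda>\<tau>. {A \<in> \<Omega>. ?K A = \<tau>}) 0 X"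
      by (rule calm_level_sets_mono[OF M zero_less_one bounds(2)]) (rule iffD2[OF zero])
  qed
qed

text \<open>
  The common form of the two alternatives: for (a), \<open>C\<close> is the whole matrix space \<open>E\<close>, and for (b)
  it is the cone of positive semidefinite matrices.
\<close>
lemma rank_constraint_error_bound:
  fixes \<Omega> A C E :: "(real^'m^'n) set"
  assumes E: "subspace E" "A \<subseteq> E" "C \<subseteq> E" and cl: "closed A" "closed C"
    and \<Omega>: "\<Omega> = A \<inter> C"
    and dist: "\<And>Z. Z \<in> C \<Longrightarrow> infdist Z (low_rank C r) \<le> nuclear_norm Z - ky_fan_norm r Z"
    and X: "X \<in> low_rank \<Omega> r"
    and qual: "uminus ` limiting_normal_cone E A X \<inter> limiting_normal_cone E (low_rank C r) X = {0}"
  shows "\<exists>c>0. \<exists>\<delta>>0. \<forall>Z\<in>\<Omega> \<inter> cball X \<delta>.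
    infdist Z (low_rank \<Omega> r) \<le> c * (nuclear_norm Z - ky_fan_norm r Z)"
proof -
  have int: "A \<inter> low_rank C r = low_rank \<Omega> r"
    by (auto simp: low_rank_def \<Omega>)
  have sub: "low_rank C r \<subseteq> E"
    using E(3) by (auto simp: low_rank_def)
  have mem: "X \<in> A" "X \<in> low_rank C r"
    using X unfolding int[symmetric] by auto
  obtain c \<delta> where c: "c > 0" "\<delta> > 0"
    and err: "\<forall>Z\<in>A \<inter> cball X \<delta>. infdist Z (low_rank \<Omega> r) \<le> c * infdist Z (low_rank C r)"
    using normal_qualification_error_bound[OF E(1,2) sub cl(1) closed_low_rank[OF cl(2)] mem] qual
    unfolding int by blast
  have "infdist Z (low_rank \<Omega> r) \<le> c * (nuclear_norm Z - ky_fan_norm r Z)"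
    if Z: "Z \<in> \<Omega> \<inter> cball X \<delta>" for Z
  proof -
    have "infdist Z (low_rank \<Omega> r) \<le> c * infdist Z (low_rank C r)"
      using err Z \<Omega> by blast
    also have "\<dots> \<le> c * (nuclear_norm Z - ky_fan_norm r Z)"
      using dist[of Z] Z c(1) \<Omega> by (intro mult_left_mono) auto
    finally show ?thesis .
  qed
  then show ?thesis using c by blast
qed

text \<open>
  At an infeasible point, closedness of the set of matrices of rank at most \<open>r\<close> and the
  distance estimate by truncation bound the penalty from below.
\<close>
lemma rank_constraint_exact_penalization:
  fixes \<Omega> :: "(real^'m^'n) set" and f :: "real^'m^'n \<Rightarrow> ereal"
  assumes \<Omega>: "closed \<Omega>" and r: "r \<in> {1..CARD('n)}" and ne: "low_rank \<Omega> r \<noteq> {}"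
    and f: "bounded_below_on \<Omega> f" "coercive_on \<Omega> f" "locally_lipschitz_on \<Omega> f"
    and err: "\<And>X. X \<in> low_rank \<Omega> r \<Longrightarrow> \<exists>c>0. \<exists>\<delta>>0. \<forall>Z\<in>\<Omega> \<inter> cball X \<delta>.
      infdist Z (low_rank \<Omega> r) \<le> c * (nuclear_norm Z - ky_fan_norm r Z)"
  shows "\<exists>\<rho>0>0. \<forall>\<rho>\<ge>\<rho>0.
    global_minimizers \<Omega> (\<lambda>X. f X + ereal (\<rho> * (nuclear_norm X - H_fun r X)))
      = global_minimizers (low_rank \<Omega> r) f"
proof (rule exact_penalization[OF \<Omega> closed_low_rank[OF \<Omega>] _ ne f])
  note K_le = nuclear_minus_H_bounds(2)[OF r]
  have rn: "r \<le> CARD('n)" using r by simp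
  note K_nonneg = nuclear_minus_ky_fan_nonneg[OF rn]
  show "low_rank \<Omega> r \<subseteq> \<Omega>"
    by (auto simp: low_rank_def)
  show T: "0 \<le> nuclear_norm Z - H_fun r Z" for Z :: "real^'m^'n"
    using K_le[of Z] K_nonneg[of Z] by simp
  show "nuclear_norm Z - H_fun r Z = 0" if "Z \<in> low_rank \<Omega> r" for Z
  proof -
    have "nuclear_norm Z - ky_fan_norm r Z = 0"
      using that rank_le_iff_nuclear_eq_ky_fan[OF rn, of Z] by (simp add: low_rank_def)
    then show ?thesis
      using nuclear_minus_H_bounds(1)[OF r, of Z] T[of Z] by simp
  qed
  show "\<exists>c. \<exists>\<delta>>0. \<forall>Z\<in>\<Omega> \<inter> cball X \<delta>. infdist Z (low_rank \<Omega> r) \<le> c * (nuclear_norm Z - H_fun r Z)"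
    if X: "X \<in> low_rank \<Omega> r" for X
  proof -
    obtain c \<delta> where c: "c > 0" "\<delta> > 0"
      and bound: "\<forall>Z\<in>\<Omega> \<inter> cball X \<delta>. infdist Z (low_rank \<Omega> r) \<le> c * (nuclear_norm Z - ky_fan_norm r Z)"
      using err[OF X] by blast
    have "infdist Z (low_rank \<Omega> r) \<le> (c * 2) * (nuclear_norm Z - H_fun r Z)" if "Z \<in> \<Omega> \<inter> cball X \<delta>" for Z
    proof -
      have "infdist Z (low_rank \<Omega> r) \<le> c * (nuclear_norm Z - ky_fan_norm r Z)"
        using bound that by blast
      also have "\<dots> \<le> c * (2 * (nuclear_norm Z - H_fun r Z))"
        using K_le[of Z] c(1) by (intro mult_left_mono) auto
      finally show ?thesis by (simp only: mult.assoc)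
    qed
    then show ?thesis using c(2) by blast
  qed
  show "\<exists>c>0. \<exists>\<delta>>0. \<forall>Z\<in>\<Omega> \<inter> cball X \<delta>. c \<le> nuclear_norm Z - H_fun r Z"
    if X: "X \<in> \<Omega> - low_rank \<Omega> r" for X
  proof -
    let ?L = "low_rank (UNIV :: (real^'m^'n) set) r"
    define d where "d = infdist X ?L"
    have "closed ?L"
      by (simp add: closed_low_rank)
    moreover have "?L \<noteq> {}"
      using ne by (auto simp: low_rank_def)
    moreover have "X \<notin> ?L"
      using X by (auto simp: low_rank_def)
    ultimately have d: "d > 0"
      unfolding d_def by (rule infdist_pos_not_in_closed)
    have "d / 4 \<le> nuclear_norm Z - H_fun r Z" if "Z \<in> \<Omega> \<inter> cball X (d / 2)" for Z
    proof -
      have "d \<le> infdist Z ?L + dist X Z"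
        unfolding d_def by (rule infdist_triangle)
      then have "d / 2 \<le> infdist Z ?L"
        using that by simp
      also have "\<dots> \<le> nuclear_norm Z - ky_fan_norm r Z"
        by (rule infdist_low_rank_le[OF rn])
      also have "\<dots> \<le> 2 * (nuclear_norm Z - H_fun r Z)"
        by (rule K_le)
      finally show ?thesis by simp
    qed
    then show ?thesis
      using d by (intro exI[of _ "d / 4"] exI[of _ "d / 2"] conjI) auto
  qed
qed

lemma exact_penalization_rectangular:
  fixes \<Omega> :: "(real^'m^'n) set" and f :: "real^'m^'n \<Rightarrow> ereal"
  assumes \<Omega>: "closed \<Omega>" and r: "r \<in> {1..CARD('n)}" and ne: "low_rank \<Omega> r \<noteq> {}"
    and f: "bounded_below_on UNIV f" "coercive_on \<Omega> f" "locally_lipschitz_on \<Omega> f"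
    and qual: "\<forall>X\<in>low_rank \<Omega> r. uminus ` limiting_normal_cone UNIV \<Omega> X
                \<inter> limiting_normal_cone UNIV (low_rank UNIV r) X = {0}"
  shows "\<exists>\<rho>0>0. \<forall>\<rho>\<ge>\<rho>0.
    global_minimizers \<Omega> (\<lambda>X. f X + ereal (\<rho> * (nuclear_norm X - H_fun r X)))
      = global_minimizers (low_rank \<Omega> r) f"
proof (rule rank_constraint_exact_penalization[OF \<Omega> r ne _ f(2,3)])
  show "bounded_below_on \<Omega> f"
    using f(1) by (auto simp: bounded_below_on_def)
  have rn: "r \<le> CARD('n)" using r by simp
  show "\<exists>c>0. \<exists>\<delta>>0. \<forall>Z\<in>\<Omega> \<inter> cball X \<delta>.
      infdist Z (low_rank \<Omega> r) \<le> c * (nuclear_norm Z - ky_fan_norm r Z)" if X: "X \<in> low_rank \<Omega> r" for X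
    by (rule rank_constraint_error_bound[where E = UNIV and A = \<Omega> and C = UNIV])
       (use \<Omega> X qual infdist_low_rank_le[OF rn] in simp_all)
qed

lemma exact_penalization_symmetric:
  fixes \<Omega> :: "(real^'n^'n) set" and f :: "real^'n^'n \<Rightarrow> ereal"
  assumes sub: "\<Omega> \<subseteq> sym_matrices" and \<Omega>: "closed \<Omega>" and r: "r \<in> {1..CARD('n)}" and ne: "low_rank \<Omega> r \<noteq> {}"
    and f: "bounded_below_on sym_matrices f" "coercive_on \<Omega> f" "locally_lipschitz_on \<Omega> f"
    and qual: "(\<forall>X\<in>low_rank \<Omega> r. uminus ` limiting_normal_cone sym_matrices \<Omega> X
              \<inter> limiting_normal_cone sym_matrices (low_rank sym_matrices r) X = {0})
         \<or>
         (\<exists>\<Xi>. \<Xi> \<subseteq> sym_matrices \<and> closed \<Xi> \<and> \<Omega> = psd_matrices \<inter> \<Xi> \<and>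
            (\<forall>X\<in>low_rank \<Omega> r.
               uminus ` limiting_normal_cone sym_matrices \<Xi> X
                 \<inter> limiting_normal_cone sym_matrices (low_rank psd_matrices r) X = {0}))"
  shows "\<exists>\<rho>0>0. \<forall>\<rho>\<ge>\<rho>0.
    global_minimizers \<Omega> (\<lambda>X. f X + ereal (\<rho> * (nuclear_norm X - H_fun r X)))
      = global_minimizers (low_rank \<Omega> r) f"
proof (rule rank_constraint_exact_penalization[OF \<Omega> r ne _ f(2,3)])
  show "bounded_below_on \<Omega> f"
    using f(1) sub by (auto simp: bounded_below_on_def)
  have rn: "r \<le> CARD('n)" using r by simp
  fix X assume X: "X \<in> low_rank \<Omega> r"
  from qual show "\<exists>c>0. \<exists>\<delta>>0. \<forall>Z\<in>\<Omega> \<inter> cball X \<delta>.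
      infdist Z (low_rank \<Omega> r) \<le> c * (nuclear_norm Z - ky_fan_norm r Z)"
  proof (elim disjE exE conjE)
    assume "\<forall>X\<in>low_rank \<Omega> r. uminus ` limiting_normal_cone sym_matrices \<Omega> X
              \<inter> limiting_normal_cone sym_matrices (low_rank sym_matrices r) X = {0}"
    then have q: "uminus ` limiting_normal_cone sym_matrices \<Omega> X
              \<inter> limiting_normal_cone sym_matrices (low_rank sym_matrices r) X = {0}"
      using X by blast
    have "\<Omega> = \<Omega> \<inter> sym_matrices"
      using sub by blast
    from rank_constraint_error_bound[OF subspace_sym_matrices sub order_refl \<Omega>
        closed_subspace[OF subspace_sym_matrices] this infdist_low_rank_sym_le[OF rn] X q]
    show ?thesis .
  next
    fix \<Xi> :: "(real^'n^'n) set"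
    assume \<Xi>: "\<Xi> \<subseteq> sym_matrices" "closed \<Xi>" "\<Omega> = psd_matrices \<inter> \<Xi>"
      and "\<forall>X\<in>low_rank \<Omega> r. uminus ` limiting_normal_cone sym_matrices \<Xi> X
                 \<inter> limiting_normal_cone sym_matrices (low_rank psd_matrices r) X = {0}"
    then have q: "uminus ` limiting_normal_cone sym_matrices \<Xi> X
                 \<inter> limiting_normal_cone sym_matrices (low_rank psd_matrices r) X = {0}"
      using X by blast
    have "(psd_matrices :: (real^'n^'n) set) \<subseteq> sym_matrices"
      by (auto simp: psd_matrices_def)
    moreover have "\<Omega> = \<Xi> \<inter> psd_matrices"
      using \<Xi>(3) by blast
    ultimately show ?thesis
      by (intro rank_constraint_error_bound[OF subspace_sym_matrices \<Xi>(1) _ \<Xi>(2)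
          closed_psd_matrices _ infdist_low_rank_psd_le[OF rn] X q])
  qed
qed

theorem theorem4p3:
  shows
    "(CARD('n::finite) \<le> CARD('m::finite) \<longrightarrow>
       (\<forall>(\<Omega> :: (real^'m^'n) set) (r::nat) (f :: real^'m^'n \<Rightarrow> ereal).
          closed \<Omega> \<and> r \<in> {1..CARD('n)} \<and> low_rank \<Omega> r \<noteq> {} \<and>
          bounded_below_on UNIV f \<and> coercive_on \<Omega> f \<and> locally_lipschitz_on \<Omega> f \<longrightarrow>
          (\<forall>X\<in>low_rank \<Omega> r. calm_at (S_map \<Omega> r) 0 X \<longleftrightarrow> calm_at (M_map \<Omega> r) 0 X) \<and>
          ((\<forall>X\<in>low_rank \<Omega> r.
              uminus ` limiting_normal_cone UNIV \<Omega> X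
                \<inter> limiting_normal_cone UNIV (low_rank UNIV r) X = {0}) \<longrightarrow>
           (\<exists>\<rho>0>0. \<forall>\<rho>\<ge>\<rho>0.
              global_minimizers \<Omega> (\<lambda>X. f X + ereal (\<rho> * (nuclear_norm X - H_fun r X)))
                = global_minimizers (low_rank \<Omega> r) f))))
     \<and>
     (\<forall>(\<Omega> :: (real^'n^'n) set) (r::nat) (f :: real^'n^'n \<Rightarrow> ereal).
        \<Omega> \<subseteq> sym_matrices \<and> closed \<Omega> \<and> r \<in> {1..CARD('n)} \<and> low_rank \<Omega> r \<noteq> {} \<and>
        bounded_below_on sym_matrices f \<and> coercive_on \<Omega> f \<and> locally_lipschitz_on \<Omega> f \<longrightarrow>
        (\<forall>X\<in>low_rank \<Omega> r. calm_at (S_map \<Omega> r) 0 X \<longleftrightarrow> calm_at (M_map \<Omega> r) 0 X) \<and>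
        ((\<forall>X\<in>low_rank \<Omega> r.
            uminus ` limiting_normal_cone sym_matrices \<Omega> X
              \<inter> limiting_normal_cone sym_matrices (low_rank sym_matrices r) X = {0})
         \<or>
         (\<exists>\<Xi>. \<Xi> \<subseteq> sym_matrices \<and> closed \<Xi> \<and> \<Omega> = psd_matrices \<inter> \<Xi> \<and>
            (\<forall>X\<in>low_rank \<Omega> r.
               uminus ` limiting_normal_cone sym_matrices \<Xi> X
                 \<inter> limiting_normal_cone sym_matrices (low_rank psd_matrices r) X = {0}))
         \<longrightarrow>
         (\<exists>\<rho>0>0. \<forall>\<rho>\<ge>\<rho>0.
            global_minimizers \<Omega> (\<lambda>X. f X + ereal (\<rho> * (nuclear_norm X - H_fun r X)))
              = global_minimizers (low_rank \<Omega> r) f)))"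
proof (intro conjI impI allI)
  fix \<Omega> :: "(real^'m^'n) set" and r :: nat and f :: "real^'m^'n \<Rightarrow> ereal"
  assume "closed \<Omega> \<and> r \<in> {1..CARD('n)} \<and> low_rank \<Omega> r \<noteq> {} \<and>
    bounded_below_on UNIV f \<and> coercive_on \<Omega> f \<and> locally_lipschitz_on \<Omega> f"
  then have *: "closed \<Omega>" "r \<in> {1..CARD('n)}" "low_rank \<Omega> r \<noteq> {}"
    "bounded_below_on UNIV f" "coercive_on \<Omega> f" "locally_lipschitz_on \<Omega> f"
    by blast+
  show "\<forall>X\<in>low_rank \<Omega> r. calm_at (S_map \<Omega> r) 0 X \<longleftrightarrow> calm_at (M_map \<Omega> r) 0 X"
    using calm_S_map_iff_calm_M_map[OF *(2)] by blast
  assume "\<forall>X\<in>low_rank \<Omega> r. uminus ` limiting_normal_cone UNIV \<Omega> X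
      \<inter> limiting_normal_cone UNIV (low_rank UNIV r) X = {0}"
  from exact_penalization_rectangular[OF * this]
  show "\<exists>\<rho>0>0. \<forall>\<rho>\<ge>\<rho>0.
    global_minimizers \<Omega> (\<lambda>X. f X + ereal (\<rho> * (nuclear_norm X - H_fun r X)))
      = global_minimizers (low_rank \<Omega> r) f" .
next
  fix \<Omega> :: "(real^'n^'n) set" and r :: nat and f :: "real^'n^'n \<Rightarrow> ereal"
  assume "\<Omega> \<subseteq> sym_matrices \<and> closed \<Omega> \<and> r \<in> {1..CARD('n)} \<and> low_rank \<Omega> r \<noteq> {} \<and>
    bounded_below_on sym_matrices f \<and> coercive_on \<Omega> f \<and> locally_lipschitz_on \<Omega> f"
  then have *: "\<Omega> \<subseteq> sym_matrices" "closed \<Omega>" "r \<in> {1..CARD('n)}" "low_rank \<Omega> r \<noteq> {}"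
    "bounded_below_on sym_matrices f" "coercive_on \<Omega> f" "locally_lipschitz_on \<Omega> f"
    by blast+
  show "\<forall>X\<in>low_rank \<Omega> r. calm_at (S_map \<Omega> r) 0 X \<longleftrightarrow> calm_at (M_map \<Omega> r) 0 X"
    using calm_S_map_iff_calm_M_map[OF *(3)] by blast
  assume "(\<forall>X\<in>low_rank \<Omega> r. uminus ` limiting_normal_cone sym_matrices \<Omega> X
        \<inter> limiting_normal_cone sym_matrices (low_rank sym_matrices r) X = {0})
    \<or> (\<exists>\<Xi>. \<Xi> \<subseteq> sym_matrices \<and> closed \<Xi> \<and> \<Omega> = psd_matrices \<inter> \<Xi> \<and>
        (\<forall>X\<in>low_rank \<Omega> r. uminus ` limiting_normal_cone sym_matrices \<Xi> X
          \<inter> limiting_normal_cone sym_matrices (low_rank psd_matrices r) X = {0}))"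
  from exact_penalization_symmetric[OF * this]
  show "\<exists>\<rho>0>0. \<forall>\<rho>\<ge>\<rho>0.
    global_minimizers \<Omega> (\<lambda>X. f X + ereal (\<rho> * (nuclear_norm X - H_fun r X)))
      = global_minimizers (low_rank \<Omega> r) f" .
qed

end
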